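(* Let $D$ be a database with $n$ rows and $\ell$ attributes over an alphabet of size $c$, and let $k\ge 2$. Then an optimal (minimum-cost) $k$-anonymization of $D$ can be computed in $2^{O(k^2(2c)^{\ell})}+O(n\ell)$ time.
   Context: A database is a matrix in $\Sigma^{n\times\ell}$ with $|\Sigma|=c$; it is $k$-anonymous if every row is identical to at least $k-1$ other rows. A $k$-anonymization (suppression model) replaces some entries by a symbol $\star\notin\Sigma$ to make the database $k$-anonymous; its cost is the number of $\star$'s introduced. *)

theory Defs
  imports "Jordan_Normal_Form.Matrix"
begin

section \<open>Optimal \<open>k\<close>-anonymization by suppression\<close>

definition k_anonymous :: "nat \<Rightarrow> 'a mat \<Rightarrow> bool" where
  "k_anonymous k D \<longleftrightarrow>
     (\<forall>i < dim_row D. k - 1 \<le> card {j. j < dim_row D \<and> j \<noteq> i \<and> row D j = row D i})"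

text \<open>A suppressed database has entries of type \<^typ>\<open>'a option\<close>; \<^const>\<open>None\<close> is the symbol
  \<open>\<star>\<close>, so \<open>\<star>\<close> is automatically outside the alphabet.\<close>

definition suppression :: "'a mat \<Rightarrow> 'a option mat \<Rightarrow> bool" where
  "suppression D E \<longleftrightarrow> dim_row E = dim_row D \<and> dim_col E = dim_col D \<and>
     (\<forall>i < dim_row D. \<forall>j < dim_col D. E $$ (i, j) = None \<or> E $$ (i, j) = Some (D $$ (i, j)))"

definition cost :: "'a option mat \<Rightarrow> nat" where
  "cost E = card {(i, j). i < dim_row E \<and> j < dim_col E \<and> E $$ (i, j) = None}"

definition k_anonymization :: "nat \<Rightarrow> 'a mat \<Rightarrow> 'a option mat \<Rightarrow> bool" where
  "k_anonymization k D E \<longleftrightarrow> suppression D E \<and> k_anonymous k E"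

definition optimal_k_anonymization :: "nat \<Rightarrow> 'a mat \<Rightarrow> 'a option mat \<Rightarrow> bool" where
  "optimal_k_anonymization k D E \<longleftrightarrow> is_arg_min cost (k_anonymization k D) E"


section \<open>A random access machine with \<open>w\<close>-bit words\<close>

text \<open>A program is a structured command over finitely many named registers and finitely many named
  arrays of words (a fixed number of arrays can be interleaved in a single memory at the price of a
  constant factor). The only arithmetic operations are addition and truncated subtraction, and
  every operation has unit cost. Overflow is not wrapped around: a computation that would produce a
  value of more than \<open>w\<close> bits is stuck, hence has no execution.\<close>

record state =
  regs :: "string \<Rightarrow> nat"
  mem :: "string \<Rightarrow> nat \<Rightarrow> nat"

datatype expr =
    Const nat
  | Reg string
  | Load string expr
  | Add expr expr
  | Sub expr expr

primrec val :: "state \<Rightarrow> expr \<Rightarrow> nat" where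
  "val s (Const m) = m"
| "val s (Reg r) = regs s r"
| "val s (Load a e) = mem s a (val s e)"
| "val s (Add e f) = val s e + val s f"
| "val s (Sub e f) = val s e - val s f"

primrec fits :: "nat \<Rightarrow> state \<Rightarrow> expr \<Rightarrow> bool" where
  "fits w s (Const m) \<longleftrightarrow> m < 2 ^ w"
| "fits w s (Reg r) \<longleftrightarrow> regs s r < 2 ^ w"
| "fits w s (Load a e) \<longleftrightarrow> fits w s e \<and> mem s a (val s e) < 2 ^ w"
| "fits w s (Add e f) \<longleftrightarrow> fits w s e \<and> fits w s f \<and> val s e + val s f < 2 ^ w"
| "fits w s (Sub e f) \<longleftrightarrow> fits w s e \<and> fits w s f"

primrec ops :: "expr \<Rightarrow> nat" where
  "ops (Const m) = 1"
| "ops (Reg r) = 1"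
| "ops (Load a e) = 1 + ops e"
| "ops (Add e f) = 1 + ops e + ops f"
| "ops (Sub e f) = 1 + ops e + ops f"

datatype com =
    Skip
  | Assign string expr
  | Store string expr expr
  | Seq com com
  | Cond expr com com
  | While expr com

text \<open>\<open>exec w p s t s'\<close>: on words of \<open>w\<close> bits, the program \<open>p\<close> started in \<open>s\<close> halts in \<open>s'\<close> after
  exactly \<open>t\<close> steps. Conditions count as true when they are nonzero.\<close>

inductive exec :: "nat \<Rightarrow> com \<Rightarrow> state \<Rightarrow> nat \<Rightarrow> state \<Rightarrow> bool" for w :: nat where
  Skip: "exec w Skip s 1 s"
| Assign: "fits w s e \<Longrightarrow>
    exec w (Assign r e) s (1 + ops e) (s\<lparr>regs := (regs s)(r := val s e)\<rparr>)"
| Store: "fits w s e \<Longrightarrow> fits w s f \<Longrightarrow>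
    exec w (Store a e f) s (1 + ops e + ops f)
      (s\<lparr>mem := (mem s)(a := (mem s a)(val s e := val s f))\<rparr>)"
| Seq: "exec w p s t s' \<Longrightarrow> exec w q s' t' s'' \<Longrightarrow> exec w (Seq p q) s (t + t') s''"
| CondTrue: "fits w s e \<Longrightarrow> val s e \<noteq> 0 \<Longrightarrow> exec w p s t s' \<Longrightarrow>
    exec w (Cond e p q) s (1 + ops e + t) s'"
| CondFalse: "fits w s e \<Longrightarrow> val s e = 0 \<Longrightarrow> exec w q s t s' \<Longrightarrow>
    exec w (Cond e p q) s (1 + ops e + t) s'"
| WhileFalse: "fits w s e \<Longrightarrow> val s e = 0 \<Longrightarrow> exec w (While e p) s (1 + ops e) s"
| WhileTrue: "fits w s e \<Longrightarrow> val s e \<noteq> 0 \<Longrightarrow> exec w p s t s' \<Longrightarrow> exec w (While e p) s' t' s'' \<Longrightarrow>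
    exec w (While e p) s (1 + ops e + t + t') s''"

inductive_cases exec_SkipE: "exec w Skip s t s'"
inductive_cases exec_AssignE: "exec w (Assign r e) s t s'"
inductive_cases exec_StoreE: "exec w (Store a e f) s t s'"
inductive_cases exec_SeqE: "exec w (Seq p q) s t s'"
inductive_cases exec_CondE: "exec w (Cond e p q) s t s'"
inductive_cases exec_WhileE: "exec w (While e p) s t s'"

lemma exec_deterministic:
  "exec w p s t s' \<Longrightarrow> exec w p s u s'' \<Longrightarrow> t = u \<and> s' = s''"
proof (induction arbitrary: u s'' rule: exec.induct)
  case Skip
  from Skip.prems show ?case by (rule exec_SkipE) simp
next
  case Assign
  from Assign.prems show ?case by (rule exec_AssignE) simp
next
  case Store
  from Store.prems show ?case by (rule exec_StoreE) simp
next
  case Seq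
  from Seq.prems show ?case by (rule exec_SeqE) (auto dest: Seq.IH)
next
  case CondTrue
  from CondTrue.prems show ?case by (rule exec_CondE) (use CondTrue.hyps in \<open>auto dest: CondTrue.IH\<close>)
next
  case CondFalse
  from CondFalse.prems show ?case by (rule exec_CondE) (use CondFalse.hyps in \<open>auto dest: CondFalse.IH\<close>)
next
  case WhileFalse
  from WhileFalse.prems show ?case by (rule exec_WhileE) (use WhileFalse.hyps in auto)
next
  case WhileTrue
  from WhileTrue.prems show ?case by (rule exec_WhileE) (use WhileTrue.hyps in \<open>auto dest: WhileTrue.IH\<close>)
qed

text \<open>A database over the alphabet \<open>{..<c}\<close> is presented to a program in row-major order, together
  with its dimensions, \<open>c\<close> and \<open>k\<close>; all other memory is zero. The result is read off in row-major
  order too, with the value \<open>c\<close> standing for \<open>\<star>\<close>.\<close>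

definition input_state :: "nat \<Rightarrow> nat \<Rightarrow> nat mat \<Rightarrow> state" where
  "input_state c k D = \<lparr>
     regs = (\<lambda>_. 0)(''n'' := dim_row D, ''l'' := dim_col D, ''c'' := c, ''k'' := k),
     mem = (\<lambda>_ _. 0)(''D'' := (\<lambda>a. if a < dim_row D * dim_col D
                                 then D $$ (a div dim_col D, a mod dim_col D) else 0))\<rparr>"

definition output_mat :: "nat \<Rightarrow> nat \<Rightarrow> nat \<Rightarrow> state \<Rightarrow> nat option mat" where
  "output_mat n l c s = mat n l (\<lambda>(i, j).
     let x = mem s ''E'' (i * l + j) in if x = c then None else Some x)"

end

theory Submission
  imports Defs
begin

text \<open>Call a row together with a set of suppressed entries a copy; there are \<open>U = (2c)\<^sup>l\<close> of them. If an
  anonymization uses a copy with at least one \<open>\<star>\<close> for \<open>2k\<close> or more rows, then \<open>k\<close> of these rows can be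
  left unsuppressed at a lower cost. So in an optimal anonymization every such copy is used less than
  \<open>2k\<close> times, all other rows are left as they are, and it suffices to try \<open>(2k)\<^sup>U\<close> choices of
  multiplicities, each of which is checked and priced from the multiplicities of the rows alone. Only
  counting the rows in the beginning and distributing the copies over them in the end depend on \<open>n\<close>;
  both take constant time per entry, the latter amortized.\<close>

section \<open>Symbolic execution\<close>

text \<open>A copy keeps the symbol under each \<open>\<star>\<close>, hence the base
  \<open>2 * c\<close> and not \<open>c + 1\<close>: it determines both the row it comes from and
  what is visible of it, so the multiplicities of the copies alone decide feasibility and cost.
  Multiplicities of star-free copies may be as large as \<open>n\<close> and cannot be enumerated;
  they are taken to be what remains of each kind of row once the starred copies are fixed. The
  machine adds and subtracts but neither multiplies nor divides. In the part independent of
  \<open>n\<close>, products and quotients come from loops and running sums; the parts that touch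
  every entry look them up in tables indexed by copies, which keeps them at constant time per entry.
  An overflow has no execution, so every intermediate value needs a bound. All of them are
  polynomial in \<open>n + T\<close>, where \<open>T\<close> is the time allowed, and this is what
  the hypothesis on the word size is used for.\<close>

definition bounded :: "nat \<Rightarrow> state \<Rightarrow> bool" where
  "bounded w s \<longleftrightarrow> (\<forall>r. regs s r < 2 ^ w) \<and> (\<forall>a i. mem s a i < 2 ^ w)"

text \<open>Every computed value fits, so in a bounded state only constants and sums can cause an overflow.\<close>

primrec safe :: "nat \<Rightarrow> state \<Rightarrow> expr \<Rightarrow> bool" where
  "safe w s (Const m) \<longleftrightarrow> m < 2 ^ w"
| "safe w s (Reg r) \<longleftrightarrow> True"
| "safe w s (Load a e) \<longleftrightarrow> safe w s e"
| "safe w s (Add e f) \<longleftrightarrow> safe w s e \<and> safe w s f \<and> val s e + val s f < 2 ^ w"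
| "safe w s (Sub e f) \<longleftrightarrow> safe w s e \<and> safe w s f"

lemma fits_if_safe: "bounded w s \<Longrightarrow> safe w s e \<Longrightarrow> fits w s e"
  by (induction e) (auto simp: bounded_def)

lemma val_less_if_safe: "bounded w s \<Longrightarrow> safe w s e \<Longrightarrow> val s e < 2 ^ w"
  by (induction e) (auto simp: bounded_def intro: less_imp_diff_less)

definition setr :: "string \<Rightarrow> nat \<Rightarrow> state \<Rightarrow> state" where
  "setr r v s = s\<lparr>regs := (regs s)(r := v)\<rparr>"

definition setm :: "string \<Rightarrow> nat \<Rightarrow> nat \<Rightarrow> state \<Rightarrow> state" where
  "setm a i v s = s\<lparr>mem := (mem s)(a := (mem s a)(i := v))\<rparr>"

lemma set_simps [simp]:
  "regs (setr r v s) = (regs s)(r := v)" "mem (setr r v s) = mem s"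
  "regs (setm a i v s) = regs s" "mem (setm a i v s) = (mem s)(a := (mem s a)(i := v))"
  by (simp_all add: setr_def setm_def)

text \<open>Boundedness is assumed at the start and delivered at the end here, so that the
  specifications of programs need not mention it. \<open>Q\<close> receives the total clock
  \<open>t + t'\<close>, so costs accumulate along a sequence.\<close>

definition halts :: "nat \<Rightarrow> com \<Rightarrow> (nat \<Rightarrow> state \<Rightarrow> bool) \<Rightarrow> nat \<Rightarrow> state \<Rightarrow> bool" where
  "halts w p Q t s \<longleftrightarrow> (bounded w s \<longrightarrow> (\<exists>t' s'. exec w p s t' s' \<and> bounded w s' \<and> Q (t + t') s'))"

lemma halts_mono: "halts w p Q t s \<Longrightarrow> (\<And>t s'. Q t s' \<Longrightarrow> Q' t s') \<Longrightarrow> halts w p Q' t s"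
  unfolding halts_def by blast

text \<open>Here \<open>t\<close> is the time already elapsed in state \<open>s\<close>. Loops are left to the semantics, so that the
  simplifier executes everything else symbolically.\<close>

primrec wp :: "nat \<Rightarrow> com \<Rightarrow> (nat \<Rightarrow> state \<Rightarrow> bool) \<Rightarrow> nat \<Rightarrow> state \<Rightarrow> bool" where
  "wp w Skip Q t s \<longleftrightarrow> Q (t + 1) s"
| "wp w (Assign r e) Q t s \<longleftrightarrow> safe w s e \<and> Q (t + (1 + ops e)) (setr r (val s e) s)"
| "wp w (Store a e f) Q t s \<longleftrightarrow> safe w s e \<and> safe w s f \<and>
    Q (t + (1 + ops e + ops f)) (setm a (val s e) (val s f) s)"
| "wp w (Seq p q) Q t s \<longleftrightarrow> wp w p (wp w q Q) t s"
| "wp w (Cond e p q) Q t s \<longleftrightarrow> safe w s e \<and>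
    (val s e \<noteq> 0 \<longrightarrow> wp w p Q (t + (1 + ops e)) s) \<and> (val s e = 0 \<longrightarrow> wp w q Q (t + (1 + ops e)) s)"
| "wp w (While e p) Q t s \<longleftrightarrow> halts w (While e p) Q t s"

declare wp.simps(6) [simp del]

text \<open>Keeps the simplifier away from the rest of the program until the state reached is known.\<close>

lemma wp_cong [cong]: "t = t' \<Longrightarrow> s = s' \<Longrightarrow> wp w p Q t s = wp w p Q t' s'"
  by simp

lemma wp_mono: "wp w p Q t s \<Longrightarrow> (\<And>t s'. Q t s' \<Longrightarrow> Q' t s') \<Longrightarrow> wp w p Q' t s"
proof (induction p arbitrary: Q Q' t s)
  case (Seq p q)
  show ?case unfolding wp.simps
    by (rule Seq.IH(1)[OF Seq.prems(1)[unfolded wp.simps]], erule Seq.IH(2), erule Seq.prems(2))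
next
  case (Cond e p q)
  show ?case
    using Cond.prems(1) Cond.IH[of Q "t + (1 + ops e)" s Q'] Cond.prems(2) unfolding wp.simps by blast
next
  case (While e p)
  then show ?case unfolding wp.simps using halts_mono by blast
qed (auto simp only: wp.simps)

text \<open>The costs added to the clock never depend on its value, so an offset can be moved into
  the postcondition. This lets a cost proved from clock 0 be used in the middle of a
  program.\<close>

lemma wp_add: "wp w p (\<lambda>t'. Q (t + t')) t1 s \<Longrightarrow> wp w p Q (t + t1) s"
proof (induction p arbitrary: Q t1 s)
  case (Seq p q)
  from Seq.prems have "wp w p (\<lambda>t'. wp w q Q (t + t')) t1 s"
    unfolding wp.simps by (rule wp_mono) (rule Seq.IH(2))
  then show ?case unfolding wp.simps by (rule Seq.IH(1))
next
  case (Cond e p q)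
  show ?case
    using Cond.prems Cond.IH[of Q "t1 + (1 + ops e)" s] unfolding wp.simps add.assoc by blast
qed (simp_all only: wp.simps halts_def add.assoc)

text \<open>Soundness of the symbolic execution. For a sequence, the inner \<open>wp\<close> is
  weakened to \<open>halts\<close> by monotonicity, and then the two executions compose with their
  times added.\<close>

lemma halts_if_wp: "wp w p Q t s \<Longrightarrow> halts w p Q t s"
proof (induction p arbitrary: Q t s)
  case Skip
  then show ?case using exec.Skip unfolding halts_def by (fastforce simp only: wp.simps)
next
  case (Assign r e)
  show ?case
    unfolding halts_def
  proof
    assume b: "bounded w s"
    with Assign have "fits w s e" "val s e < 2 ^ w" "Q (t + (1 + ops e)) (setr r (val s e) s)"
      by (auto simp only: wp.simps intro: fits_if_safe val_less_if_safe)
    moreover from this(2) b have "bounded w (setr r (val s e) s)" by (auto simp: bounded_def)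
    ultimately show "\<exists>t' s'. exec w (Assign r e) s t' s' \<and> bounded w s' \<and> Q (t + t') s'"
      using exec.Assign[of w s e r] unfolding setr_def by blast
  qed
next
  case (Store a e f)
  show ?case
    unfolding halts_def
  proof
    assume b: "bounded w s"
    with Store have "fits w s e" "fits w s f" "val s f < 2 ^ w"
        "Q (t + (1 + ops e + ops f)) (setm a (val s e) (val s f) s)"
      by (auto simp only: wp.simps intro: fits_if_safe val_less_if_safe)
    moreover from this(3) b have "bounded w (setm a (val s e) (val s f) s)" by (auto simp: bounded_def)
    ultimately show "\<exists>t' s'. exec w (Store a e f) s t' s' \<and> bounded w s' \<and> Q (t + t') s'"
      using exec.Store[of w s e f a] unfolding setm_def by blast
  qed
next
  case (Seq p q)
  from Seq.prems have "wp w p (wp w q Q) t s" by (simp only: wp.simps)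
  then have "halts w p (halts w q Q) t s"
    using Seq.IH wp_mono[of w p "wp w q Q" t s "halts w q Q"] by blast
  then show ?case unfolding halts_def by (metis exec.Seq add.assoc)
next
  case (Cond e p q)
  show ?case
    unfolding halts_def
  proof
    assume b: "bounded w s"
    with Cond.prems have f: "fits w s e" by (auto simp only: wp.simps intro: fits_if_safe)
    show "\<exists>t' s'. exec w (Cond e p q) s t' s' \<and> bounded w s' \<and> Q (t + t') s'"
    proof (cases "val s e = 0")
      case True
      with Cond.prems Cond.IH(2) have "halts w q Q (t + (1 + ops e)) s" unfolding wp.simps by blast
      with b f True exec.CondFalse show ?thesis unfolding halts_def by (metis add.assoc)
    next
      case False
      with Cond.prems Cond.IH(1) have "halts w p Q (t + (1 + ops e)) s" unfolding wp.simps by blast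
      with b f False exec.CondTrue show ?thesis unfolding halts_def by (metis add.assoc)
    qed
  qed
qed (simp only: wp.simps)

section \<open>Frame conditions and rules for loops\<close>

primrec mod_regs :: "com \<Rightarrow> string set" where
  "mod_regs Skip = {}"
| "mod_regs (Assign r e) = {r}"
| "mod_regs (Store a e f) = {}"
| "mod_regs (Seq p q) = mod_regs p \<union> mod_regs q"
| "mod_regs (Cond e p q) = mod_regs p \<union> mod_regs q"
| "mod_regs (While e p) = mod_regs p"

primrec mod_mem :: "com \<Rightarrow> string set" where
  "mod_mem Skip = {}"
| "mod_mem (Assign r e) = {}"
| "mod_mem (Store a e f) = {a}"
| "mod_mem (Seq p q) = mod_mem p \<union> mod_mem q"
| "mod_mem (Cond e p q) = mod_mem p \<union> mod_mem q"
| "mod_mem (While e p) = mod_mem p"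

definition same :: "string set \<Rightarrow> string set \<Rightarrow> state \<Rightarrow> state \<Rightarrow> bool" where
  "same X Y s s' \<longleftrightarrow> (\<forall>r. r \<notin> X \<longrightarrow> regs s' r = regs s r) \<and> (\<forall>a. a \<notin> Y \<longrightarrow> mem s' a = mem s a)"

lemma sameR: "same X Y s s' \<Longrightarrow> r \<notin> X \<Longrightarrow> regs s' r = regs s r"
  and sameM: "same X Y s s' \<Longrightarrow> a \<notin> Y \<Longrightarrow> mem s' a = mem s a"
  by (auto simp: same_def)

lemma same_refl: "same X Y s s"
  by (simp add: same_def)

lemma same_trans: "same X Y s s' \<Longrightarrow> same X Y s' s'' \<Longrightarrow> same X Y s s''"
  by (auto simp: same_def)

lemma exec_same: "exec w p s t s' \<Longrightarrow> same (mod_regs p) (mod_mem p) s s'"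
  by (induction rule: exec.induct) (auto simp: same_def)

text \<open>What the program text never assigns is unchanged by every execution, so this may be
  assumed when a postcondition is proved.\<close>

lemma wp_frame:
  assumes "wp w p (\<lambda>t s'. same (mod_regs p) (mod_mem p) s s' \<longrightarrow> Q t s') t s"
  shows "wp w p Q t s"
proof -
  \<comment> \<open>The two halves of a sequence modify different sets; their frames compose only
    when stated for a common pair of supersets \<open>X\<close> and \<open>Y\<close>.\<close>
  have "wp w p Q t s" if "wp w p (\<lambda>t s'. same X Y s s' \<longrightarrow> Q t s') t s" "mod_regs p \<subseteq> X" "mod_mem p \<subseteq> Y" for X Y
    using that
  proof (induction p arbitrary: Q t s)
    case (Seq p q)
    let ?Q = "wp w q (\<lambda>t s'. same X Y s s' \<longrightarrow> Q t s')"
    have "wp w p (\<lambda>t s1. same X Y s s1 \<longrightarrow> wp w q Q t s1) t s"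
    proof (rule wp_mono[of w p ?Q], goal_cases)
      case 1
      show ?case using Seq.prems(1) by (simp only: wp.simps)
    next
      case (2 t s1)
      have "wp w q Q t s1" if "same X Y s s1"
        by (rule Seq.IH(2)[OF wp_mono[OF 2]]) (use that Seq.prems same_trans in auto)
      then show ?case by blast
    qed
    from Seq.IH(1)[OF this] Seq.prems show ?case by (auto simp only: wp.simps mod_regs.simps mod_mem.simps)
  next
    case (Cond e p q)
    then show ?case by (auto simp only: wp.simps mod_regs.simps mod_mem.simps Un_subset_iff)
  next
    case (While e p)
    have "same X Y s s'" if "exec w (While e p) s t s'" for t s'
      using exec_same[OF that] While.prems by (auto simp: same_def)
    with While.prems(1) show ?case unfolding wp.simps halts_def by blast
  qed (auto simp: same_def)
  with assms show ?thesis by blast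
qed

text \<open>The rule by which a specified subprogram is used: its cost is added to the current
  clock, and everything it does not assign is known to be unchanged.\<close>

lemma wp_conseq:
  assumes "wp w p Q 0 s" "\<And>t' s'. Q t' s' \<Longrightarrow> same (mod_regs p) (mod_mem p) s s' \<Longrightarrow> Q' (t + t') s'"
  shows "wp w p Q' t s"
proof -
  have "wp w p (\<lambda>t'. Q' (t + t')) 0 s"
    by (rule wp_frame) (rule wp_mono[OF assms(1)], use assms(2) in blast)
  from wp_add[OF this] show ?thesis by simp
qed

text \<open>Induction on the measure \<open>\<mu>\<close> gives termination. The invariant may speak
  of the clock, so amortized time bounds can be expressed by it as well.\<close>

lemma wp_While:
  assumes start: "I t0 s"
    and safe: "\<And>t s'. I t s' \<Longrightarrow> same (mod_regs p) (mod_mem p) s s' \<Longrightarrow> bounded w s' \<Longrightarrow> safe w s' e"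
    and step: "\<And>t s'. I t s' \<Longrightarrow> same (mod_regs p) (mod_mem p) s s' \<Longrightarrow> bounded w s' \<Longrightarrow> val s' e \<noteq> 0 \<Longrightarrow>
      wp w p (\<lambda>t s''. I t s'' \<and> \<mu> s'' < (\<mu> s' :: nat)) (t + (1 + ops e)) s'"
    and stop: "\<And>t s'. I t s' \<Longrightarrow> same (mod_regs p) (mod_mem p) s s' \<Longrightarrow> bounded w s' \<Longrightarrow> val s' e = 0 \<Longrightarrow>
      Q (t + (1 + ops e)) s'"
  shows "wp w (While e p) Q t0 s"
  unfolding wp.simps halts_def
proof
  assume b0: "bounded w s"
  have "\<exists>t' s''. exec w (While e p) s' t' s'' \<and> bounded w s'' \<and> Q (t + t') s''"
    if "I t s'" "same (mod_regs p) (mod_mem p) s s'" "bounded w s'" for t s'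
    using that
  proof (induction "\<mu> s'" arbitrary: t s' rule: less_induct)
    case less
    note f = fits_if_safe[OF less.prems(3) safe[OF less.prems]]
    show ?case
    proof (cases "val s' e = 0")
      case True
      with exec.WhileFalse[OF f True] stop[OF less.prems True] less.prems(3) show ?thesis by blast
    next
      case False
      from halts_if_wp[OF step[OF less.prems False]] less.prems(3) obtain t1 s1 where 1: "exec w p s' t1 s1"
        "bounded w s1" "I (t + (1 + ops e) + t1) s1" "\<mu> s1 < \<mu> s'"
        unfolding halts_def by blast
      from less.hyps[OF 1(4,3) same_trans[OF less.prems(2) exec_same[OF 1(1)]] 1(2)]
      obtain t2 s2 where 2: "exec w (While e p) s1 t2 s2" "bounded w s2" "Q (t + (1 + ops e) + t1 + t2) s2"
        by blast
      from 2(3) have "Q (t + (1 + ops e + t1 + t2)) s2" by (simp add: ac_simps)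
      with exec.WhileTrue[OF f False 1(1) 2(1)] 2(2) show ?thesis by blast
    qed
  qed
  from this[OF start same_refl b0] show "\<exists>t s'. exec w (While e p) s t s' \<and> bounded w s' \<and> Q (t0 + t) s'" .
qed

definition For :: "string \<Rightarrow> string \<Rightarrow> com \<Rightarrow> com" where
  "For i x p = Seq (Assign i (Const 0))
     (While (Sub (Reg x) (Reg i)) (Seq p (Assign i (Add (Reg i) (Const 1)))))"

lemma mod_For [simp]: "mod_regs (For i x p) = insert i (mod_regs p)" "mod_mem (For i x p) = mod_mem p"
  by (auto simp: For_def)

text \<open>Loop control costs 8 per round, 4 for the test and 4 for the increment. The 6 at the end
  collects the initial assignment (2) and the last, failing test (4).\<close>

lemma wp_For:
  assumes ix: "i \<notin> mod_regs p" "x \<notin> mod_regs p" "i \<noteq> x" and N: "regs s x = N"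
    and start: "I 0 t0 (setr i 0 s)"
    and step: "\<And>j t s'. j < N \<Longrightarrow> I j t s' \<Longrightarrow> regs s' i = j \<Longrightarrow> regs s' x = N \<Longrightarrow>
      same (insert i (mod_regs p)) (mod_mem p) s s' \<Longrightarrow> bounded w s' \<Longrightarrow>
      wp w p (\<lambda>t s''. I (Suc j) (t + 8) (setr i (Suc j) s'')) t s'"
    and stop: "\<And>t s'. I N t s' \<Longrightarrow> regs s' i = N \<Longrightarrow> same (insert i (mod_regs p)) (mod_mem p) s s' \<Longrightarrow> Q (t + 6) s'"
  shows "wp w (For i x p) Q t0 s"
proof -
  let ?s = "setr i 0 s"
  let ?e = "Sub (Reg x) (Reg i)"
  let ?p = "Seq p (Assign i (Add (Reg i) (Const 1)))"
  \<comment> \<open>The clock of \<open>I\<close> runs 2 behind the real one, so that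
    \<open>I\<close> starts at \<open>t0\<close>; the initial assignment is charged only at the
    end.\<close>
  let ?I = "\<lambda>t s'. \<exists>j \<le> N. regs s' i = j \<and> I j (t - 2) s' \<and> 2 \<le> t"
  have sm: "same (insert i (mod_regs p)) (mod_mem p) s s'" if "same (mod_regs ?p) (mod_mem ?p) ?s s'" for s'
    using that by (auto simp: same_def)
  have x: "regs s' x = N" if "same (mod_regs ?p) (mod_mem ?p) ?s s'" for s'
    using sameR[OF sm[OF that], of x] ix N by simp
  have "wp w (While ?e ?p) Q (t0 + 2) ?s"
  proof (rule wp_While[where I = ?I and \<mu> = "\<lambda>s'. N - regs s' i"])
    show "?I (t0 + 2) ?s" using start by simp
    show "safe w s' ?e" for s' by simp
  next
    fix t s' assume *: "?I t s'" "same (mod_regs ?p) (mod_mem ?p) ?s s'" "bounded w s'" "val s' ?e \<noteq> 0"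
    then obtain j where j: "j < N" "regs s' i = j" "I j (t - 2) s'" "2 \<le> t" using x[OF *(2)] by auto
    from *(3) x[OF *(2)] have "N < 2 ^ w" by (auto simp: bounded_def)
    with j have w: "Suc j < 2 ^ w" by simp
    have i: "regs s'' i = j" if "same (mod_regs p) (mod_mem p) s' s''" for s''
      using sameR[OF that ix(1)] j by simp
    let ?Q = "wp w (Assign i (Add (Reg i) (Const 1))) (\<lambda>t s''. ?I t s'' \<and> N - regs s'' i < N - regs s' i)"
    have Q: "?Q (6 + t') s''"
      if "same (mod_regs p) (mod_mem p) s' s''" "I (Suc j) (t' + 8) (setr i (Suc j) s'')"
      for t' s''
      using that(2) w j i[OF that(1)] by (simp add: numeral_eq_Suc)
    have "wp w p (\<lambda>t' s''. ?Q (6 + t') s'') (t - 2) s'"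
      by (rule wp_frame[OF wp_mono[OF step[OF j(1,3,2) x[OF *(2)] sm[OF *(2)] *(3)]]]) (use Q in blast)
    moreover have "6 + (t - 2) = t + (1 + ops ?e)" using j(4) by simp
    ultimately show "wp w ?p (\<lambda>t s''. ?I t s'' \<and> N - regs s'' i < N - regs s' i) (t + (1 + ops ?e)) s'"
      unfolding wp.simps(4) using wp_add[of w p ?Q 6 "t - 2" s'] by metis
  next
    fix t s' assume *: "?I t s'" "same (mod_regs ?p) (mod_mem ?p) ?s s'" "val s' ?e = 0"
    then have j: "regs s' i = N" "I N (t - 2) s'" "2 \<le> t" using x[OF *(2)] by auto
    have "t - 2 + 6 = t + (1 + ops ?e)" using j(3) by simp
    with stop[OF j(2,1) sm[OF *(2)]] show "Q (t + (1 + ops ?e)) s'" by metis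
  qed
  then show ?thesis unfolding For_def by (simp add: numeral_eq_Suc)
qed

section \<open>Digits\<close>

definition digit :: "nat \<Rightarrow> nat \<Rightarrow> nat \<Rightarrow> nat" where
  "digit b u j = u div b ^ j mod b"

lemma digit_0: "digit b u 0 = u mod b"
  by (simp add: digit_def)

lemma digit_Suc: "digit b u (Suc j) = digit b (u div b) j"
  by (simp add: digit_def div_mult2_eq)

lemma digit_less: "0 < b \<Longrightarrow> digit b u j < b"
  by (simp add: digit_def)

lemma digits_eqI:
  assumes "u < b ^ l" "v < b ^ l" "\<And>j. j < l \<Longrightarrow> digit b u j = digit b v j"
  shows "u = v"
  using assms
proof (induction l arbitrary: u v)
  case (Suc l)
  have "0 < b" using Suc.prems(1) by (cases b) auto
  have "u div b = v div b"
  proof (rule Suc.IH)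
    show "u div b < b ^ l" "v div b < b ^ l"
      using Suc.prems \<open>0 < b\<close> by (auto simp: less_mult_imp_div_less mult.commute)
    show "digit b (u div b) j = digit b (v div b) j" if "j < l" for j
      using Suc.prems(3)[of "Suc j"] that by (simp add: digit_Suc)
  qed
  moreover have "u mod b = v mod b" using Suc.prems(3)[of 0] by (simp add: digit_0)
  ultimately show ?case by (metis div_mult_mod_eq)
qed simp

lemma digits_exist:
  assumes "\<And>j. j < l \<Longrightarrow> d j < (b :: nat)"
  shows "\<exists>u < b ^ l. \<forall>j < l. digit b u j = d j"
  using assms
proof (induction l arbitrary: d)
  case (Suc l)
  from Suc.IH[of "\<lambda>j. d (Suc j)"] Suc.prems obtain u
    where u: "u < b ^ l" "\<forall>j < l. digit b u j = d (Suc j)" by auto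
  have d0: "d 0 < b" using Suc.prems by simp
  let ?u = "u * b + d 0"
  have "?u < (u + 1) * b" using d0 by simp
  also have "\<dots> \<le> b ^ l * b" using u(1) by (intro mult_right_mono) auto
  finally have "?u < b ^ Suc l" by (simp add: mult.commute)
  moreover have "digit b ?u j = d j" if "j < Suc l" for j
    using that u(2) d0 by (cases j) (auto simp: digit_0 digit_Suc)
  ultimately show ?case by blast
qed simp

text \<open>Stopping at 0 avoids a length parameter. With \<open>f 0 = 0\<close> leading zeros stay
  zeros, and the recursion equation holds at \<open>u = 0\<close> too, which the filling of the
  tables relies on.\<close>

fun map_digits :: "nat \<Rightarrow> (nat \<Rightarrow> nat) \<Rightarrow> nat \<Rightarrow> nat" where
  "map_digits b f u = (if b < 2 \<or> u = 0 then 0 else map_digits b f (u div b) * b + f (u mod b))"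

fun sum_digits :: "nat \<Rightarrow> (nat \<Rightarrow> nat) \<Rightarrow> nat \<Rightarrow> nat" where
  "sum_digits b f u = (if b < 2 \<or> u = 0 then 0 else sum_digits b f (u div b) + f (u mod b))"

declare map_digits.simps [simp del] sum_digits.simps [simp del]

lemma map_digits_rec:
  "2 \<le> b \<Longrightarrow> f 0 = 0 \<Longrightarrow> map_digits b f u = map_digits b f (u div b) * b + f (u mod b)"
  by (cases "u = 0") (subst map_digits.simps; simp add: map_digits.simps[of b f 0])+

lemma sum_digits_rec:
  "2 \<le> b \<Longrightarrow> f 0 = 0 \<Longrightarrow> sum_digits b f u = sum_digits b f (u div b) + f (u mod b)"
  by (cases "u = 0") (subst sum_digits.simps; simp add: sum_digits.simps[of b f 0])+

lemma digit_map_digits: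
  assumes "2 \<le> b" "f 0 = 0" "\<And>d. d < b \<Longrightarrow> f d < b"
  shows "digit b (map_digits b f u) j = f (digit b u j)"
proof (induction j arbitrary: u)
  case 0
  show ?case using assms by (simp add: digit_0 map_digits_rec[of b f u])
next
  case (Suc j)
  have "f (u mod b) < b" using assms by simp
  then have "map_digits b f u div b = map_digits b f (u div b)"
    using assms(1) by (simp add: map_digits_rec[of b f u] assms(2))
  then show ?case by (simp add: digit_Suc Suc.IH)
qed

lemma map_digits_less:
  assumes "2 \<le> b" "f 0 = 0" "\<And>d. d < b \<Longrightarrow> f d < b"
  shows "u < b ^ l \<Longrightarrow> map_digits b f u < b ^ l"
proof (induction l arbitrary: u)
  case 0
  then show ?case by (simp add: map_digits.simps[of b f 0])
next
  case (Suc l)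
  have "u div b < b ^ l" using Suc.prems assms(1) by (auto simp: less_mult_imp_div_less mult.commute)
  from Suc.IH[OF this] have "map_digits b f (u div b) + 1 \<le> b ^ l" by simp
  then have "(map_digits b f (u div b) + 1) * b \<le> b ^ l * b" by (rule mult_right_mono) simp
  moreover have "f (u mod b) < b" using assms by simp
  ultimately have "map_digits b f (u div b) * b + f (u mod b) < b ^ l * b" by simp
  then show ?case using assms by (simp add: map_digits_rec[of b f u] mult.commute)
qed

lemma sum_digits_eq_sum:
  assumes "2 \<le> b" "f 0 = 0"
  shows "u < b ^ l \<Longrightarrow> sum_digits b f u = (\<Sum>j<l. f (digit b u j))"
proof (induction l arbitrary: u)
  case 0
  then show ?case by (simp add: sum_digits.simps[of b f 0])
next
  case (Suc l)
  have "u div b < b ^ l" using Suc.prems assms(1) by (auto simp: less_mult_imp_div_less mult.commute)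
  from Suc.IH[OF this] show ?case
    using assms by (simp add: sum_digits_rec[of b f u] sum.lessThan_Suc_shift digit_0 digit_Suc del: sum.lessThan_Suc)
qed

lemma map_digits_id:
  assumes "2 \<le> b" "f 0 = 0" "\<And>d. d < b \<Longrightarrow> f d < b" "u < b ^ l"
  shows "map_digits b f u = u \<longleftrightarrow> (\<forall>j<l. f (digit b u j) = digit b u j)"
  using digits_eqI[OF map_digits_less[where f = f and u = u and l = l and b = b] assms(4)]
    assms by (metis digit_map_digits[where f = f and u = u and b = b])

text \<open>Serves to show \<open>R u \<le> u\<close> and \<open>P u \<le> u\<close>: entries needed
  for \<open>u\<close> have then been computed before, and a row precedes all of its starred copies
  in the numbering.\<close>

lemma map_digits_le: "(\<And>d. f d \<le> d) \<Longrightarrow> map_digits b f u \<le> u"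
proof (induction b f u rule: map_digits.induct)
  case (1 b f u)
  show ?case
  proof (cases "b < 2 \<or> u = 0")
    case False
    from 1 False have "map_digits b f (u div b) * b + f (u mod b) \<le> u div b * b + u mod b"
      by (intro add_mono mult_right_mono) auto
    with False show ?thesis by (simp add: map_digits.simps[of b f u])
  qed (simp add: map_digits.simps[of b f u])
qed

section \<open>Counting along fibres\<close>

lemma sum_fibres:
  fixes a :: "nat \<Rightarrow> nat"
  assumes "finite I" "finite A" "\<And>i. i \<in> I \<Longrightarrow> a i \<in> A"
  shows "(\<Sum>i\<in>I. g (a i)) = (\<Sum>u\<in>A. card {i\<in>I. a i = u} * (g u :: nat))"
proof -
  have "(\<Sum>i\<in>I. g (a i)) = (\<Sum>u\<in>A. \<Sum>i\<in>{i\<in>I. a i = u}. g (a i))"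
    using assms by (intro sum.group[symmetric]) auto
  also have "\<dots> = (\<Sum>u\<in>A. card {i\<in>I. a i = u} * g u)"
    by (intro sum.cong refl) simp
  finally show ?thesis .
qed

lemma sum_card_fibres:
  fixes a :: "nat \<Rightarrow> nat"
  assumes "finite I" "finite A"
  shows "(\<Sum>u\<in>A. card {i\<in>I. a i = u}) = card {i\<in>I. a i \<in> A}"
proof -
  have "card {i\<in>I. a i \<in> A} = (\<Sum>i\<in>{i\<in>I. a i \<in> A}. 1)" by simp
  also have "\<dots> = (\<Sum>u\<in>A. card {i\<in>{i\<in>I. a i \<in> A}. a i = u} * 1)"
    using assms by (intro sum_fibres[where g = "\<lambda>_. 1"]) auto
  also have "\<dots> = (\<Sum>u\<in>A. card {i\<in>I. a i = u})"
    by (intro sum.cong) (auto intro!: arg_cong[where f = card])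
  finally show ?thesis by simp
qed

section \<open>Row copies\<close>

locale database =
  fixes n l c k :: nat and D :: "nat mat"
  assumes c: "1 \<le> c" and k: "2 \<le> k" and l: "1 \<le> l"
    and D: "D \<in> carrier_mat n l" and el: "elements_mat D \<subseteq> {..<c}"
begin

text \<open>A number \<open>u < U\<close> encodes, through its \<open>l\<close> digits in base \<open>b\<close>, a row together with a suppression
  of it: a digit \<open>d < c\<close> is the symbol \<open>d\<close>, a digit \<open>d \<ge> c\<close> is the symbol \<open>d - c\<close> replaced by \<open>\<star>\<close>.
  \<open>R u\<close> encodes the row itself, \<open>P u\<close> what is visible of it (with the digit \<open>c\<close> for \<open>\<star>\<close>), and
  \<open>W u\<close> is the number of \<open>\<star>\<close>'s. The first column is the most significant digit.\<close>

definition "b = 2 * c"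
definition "U = b ^ l"
definition "K = 2 * k"
definition "R = map_digits b (\<lambda>d. d mod c)"
definition "P = map_digits b (min c)"
definition "W = sum_digits b (\<lambda>d. if d < c then 0 else 1)"

lemma b: "2 \<le> b" "0 < b" "c < b" "d mod c < b"
proof -
  have "d mod c < c" using c by simp
  then show "d mod c < b" by (simp add: b_def)
qed (use c in \<open>simp_all add: b_def\<close>)

lemma U0: "0 < U" using b by (simp add: U_def)

lemma digit_R: "digit b (R u) j = digit b u j mod c"
  unfolding R_def by (subst digit_map_digits) (use b in auto)

lemma digit_P: "digit b (P u) j = min c (digit b u j)"
  unfolding P_def by (subst digit_map_digits) (use b in auto)

lemma R_less: "u < U \<Longrightarrow> R u < U"
  unfolding R_def U_def by (rule map_digits_less) (use b in auto)

lemma P_less: "u < U \<Longrightarrow> P u < U"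
  unfolding P_def U_def by (rule map_digits_less) (use b in auto)

lemma W_eq: "u < U \<Longrightarrow> W u = card {j. j < l \<and> c \<le> digit b u j}"
  unfolding W_def U_def
  by (subst sum_digits_eq_sum[where l = l])
    (use b c in \<open>auto simp: sum.If_cases intro!: arg_cong[where f = card]\<close>)

text \<open>A digit is fixed by reduction modulo \<open>c\<close> exactly if it is below
  \<open>c\<close>, that is, not a \<open>\<star>\<close>. The program recognizes star-free copies
  by this test.\<close>

lemma R_eq_self_iff: "u < U \<Longrightarrow> R u = u \<longleftrightarrow> W u = 0"
proof -
  assume u: "u < U"
  have "R u = u \<longleftrightarrow> (\<forall>j<l. digit b u j mod c = digit b u j)"
    unfolding R_def by (rule map_digits_id) (use b u in \<open>auto simp: U_def\<close>)
  also have "\<dots> \<longleftrightarrow> (\<forall>j<l. digit b u j < c)"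
  proof -
    have "x mod c < c" for x using c by simp
    then have "x mod c = x \<longleftrightarrow> x < c" for x by (metis mod_less)
    then show ?thesis by simp
  qed
  also have "\<dots> \<longleftrightarrow> W u = 0" using u by (auto simp: W_eq not_le)
  finally show ?thesis .
qed

lemma R_idem: "u < U \<Longrightarrow> R (R u) = R u"
  by (rule digits_eqI[where b = b and l = l]) (use R_less in \<open>auto simp: U_def[symmetric] digit_R\<close>)

lemma W_R: "u < U \<Longrightarrow> W (R u) = 0"
  using R_eq_self_iff[of "R u"] R_idem R_less by simp

text \<open>The starred copy shows the digit \<open>c\<close> somewhere, a star-free one never does.
  So rows that lose their stars really move to a different group.\<close>

lemma P_R_neq: "u < U \<Longrightarrow> 0 < W u \<Longrightarrow> v < U \<Longrightarrow> P u \<noteq> P (R v)"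
proof
  assume "u < U" "0 < W u" "v < U" and e: "P u = P (R v)"
  then obtain j where "j < l" "c \<le> digit b u j" by (auto simp: W_eq card_gt_0_iff)
  moreover have "min c (digit b u j) = min c (digit b v j mod c)"
    using arg_cong[OF e, of "\<lambda>x. digit b x j"] by (simp add: digit_P digit_R)
  moreover have "digit b v j mod c < c" using c by simp
  ultimately show False by simp
qed

lemma P_eq_iff: "u < U \<Longrightarrow> v < U \<Longrightarrow> P u = P v \<longleftrightarrow> (\<forall>j<l. min c (digit b u j) = min c (digit b v j))"
  using digits_eqI[of "P u" b l "P v"] P_less unfolding U_def[symmetric] by (metis digit_P)

primrec horner :: "nat \<Rightarrow> nat \<Rightarrow> nat" where
  "horner i 0 = 0"
| "horner i (Suc j) = horner i j * b + D $$ (i, j)"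

definition "code i = horner i l"

lemma D_less: "i < n \<Longrightarrow> j < l \<Longrightarrow> D $$ (i, j) < c"
proof -
  assume "i < n" "j < l"
  then have "D $$ (i, j) \<in> elements_mat D" using D by (force simp: elements_mat_def)
  with el show ?thesis by blast
qed

lemma horner_less: "i < n \<Longrightarrow> j \<le> l \<Longrightarrow> horner i j < b ^ j"
proof (induction j)
  case (Suc j)
  then have "(horner i j + 1) * b \<le> b ^ j * b" by (intro mult_right_mono) auto
  moreover have "D $$ (i, j) < b" using D_less[of i j] Suc.prems b(3) by simp
  ultimately show ?case by (simp add: mult.commute)
qed simp

lemma code_less: "i < n \<Longrightarrow> code i < U"
  unfolding code_def U_def by (rule horner_less) auto

text \<open>Dividing by \<open>b ^ t\<close> drops the last \<open>t\<close> columns, and what is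
  left is the Horner value of the columns before them.\<close>

lemma code_div: "i < n \<Longrightarrow> t \<le> l \<Longrightarrow> code i div b ^ t = horner i (l - t)"
proof (induction t)
  case (Suc t)
  have "code i div b ^ Suc t = horner i (l - t) div b"
    using Suc by (simp add: div_mult2_eq mult.commute[of b])
  also have "l - t = Suc (l - Suc t)" using Suc.prems by simp
  also have "horner i (Suc (l - Suc t)) div b = horner i (l - Suc t)"
    using D_less[of i "l - Suc t"] Suc.prems b by simp
  finally show ?case .
qed (simp add: code_def)

lemma digit_code: "i < n \<Longrightarrow> j < l \<Longrightarrow> digit b (code i) (l - Suc j) = D $$ (i, j)"
  using D_less[of i j] b by (simp add: digit_def code_div)

lemma R_code: "i < n \<Longrightarrow> R (code i) = code i"
proof (rule digits_eqI[where b = b and l = l])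
  fix j assume *: "i < n" "j < l"
  have "digit b (code i) (l - Suc (l - Suc j)) = D $$ (i, l - Suc j)"
    by (rule digit_code) (use * in auto)
  moreover have "l - Suc (l - Suc j) = j" using * by simp
  ultimately show "digit b (R (code i)) j = digit b (code i) j"
    using D_less[of i "l - Suc j"] * by (simp add: digit_R)
qed (use code_less R_less in \<open>auto simp: U_def[symmetric]\<close>)

section \<open>Suppressions as assignments of copies to rows\<close>

definition assignment :: "(nat \<Rightarrow> nat) \<Rightarrow> bool" where
  "assignment a \<longleftrightarrow> (\<forall>i<n. a i < U \<and> R (a i) = code i)"

definition mat_of :: "(nat \<Rightarrow> nat) \<Rightarrow> nat option mat" where
  "mat_of a = mat n l (\<lambda>(i, j). let x = min c (digit b (a i) (l - Suc j)) in if x = c then None else Some x)"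

lemma suppression_mat_of: "assignment a \<Longrightarrow> suppression D (mat_of a)"
proof -
  assume a: "assignment a"
  have "digit b (a i) (l - Suc j) < c \<Longrightarrow> digit b (a i) (l - Suc j) = D $$ (i, j)" if "i < n" "j < l" for i j
  proof -
    assume "digit b (a i) (l - Suc j) < c"
    then have "digit b (a i) (l - Suc j) = digit b (R (a i)) (l - Suc j)" by (simp add: digit_R)
    also have "\<dots> = D $$ (i, j)" using a that by (simp add: assignment_def digit_code)
    finally show ?thesis .
  qed
  then show ?thesis using D by (auto simp: suppression_def mat_of_def Let_def min_def)
qed

lemma row_mat_of_eq_iff:
  assumes "assignment a" "i < n" "i' < n"
  shows "row (mat_of a) i = row (mat_of a) i' \<longleftrightarrow> P (a i) = P (a i')"
proof -
  let ?d = "\<lambda>i j. min c (digit b (a i) j)"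
  have "row (mat_of a) i = row (mat_of a) i' \<longleftrightarrow>
      (\<forall>j<l. (if ?d i (l - Suc j) = c then None else Some (?d i (l - Suc j))) =
        (if ?d i' (l - Suc j) = c then None else Some (?d i' (l - Suc j))))"
    using assms by (auto simp: vec_eq_iff mat_of_def Let_def)
  also have "\<dots> \<longleftrightarrow> (\<forall>j<l. ?d i (l - Suc j) = ?d i' (l - Suc j))"
    by (auto split: if_splits)
  also have "\<dots> \<longleftrightarrow> (\<forall>j<l. ?d i j = ?d i' j)"
  proof safe
    fix j assume *: "\<forall>j<l. ?d i (l - Suc j) = ?d i' (l - Suc j)" "j < l"
    from *(1)[rule_format, of "l - Suc j"] *(2) show "?d i j = ?d i' j" by (simp add: Suc_diff_Suc)
  qed auto
  also have "\<dots> \<longleftrightarrow> P (a i) = P (a i')"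
    using assms by (intro P_eq_iff[symmetric]) (auto simp: assignment_def)
  finally show ?thesis .
qed

definition "weight a = (\<Sum>i<n. W (a i))"

lemma cost_mat_of:
  assumes "assignment a"
  shows "cost (mat_of a) = weight a"
proof -
  have "{(i, j). i < dim_row (mat_of a) \<and> j < dim_col (mat_of a) \<and> mat_of a $$ (i, j) = None}
    = (SIGMA i:{..<n}. {j. j < l \<and> c \<le> digit b (a i) (l - Suc j)})"
    by (auto simp: mat_of_def Let_def min_def split: if_splits)
  then have "cost (mat_of a) = (\<Sum>i<n. card {j. j < l \<and> c \<le> digit b (a i) (l - Suc j)})"
    by (simp add: cost_def)
  also have "\<dots> = (\<Sum>i<n. W (a i))"
  proof (rule sum.cong[OF refl])
    fix i assume i: "i \<in> {..<n}"
    have "bij_betw (\<lambda>j. l - Suc j) {j. j < l \<and> c \<le> digit b (a i) (l - Suc j)} {j. j < l \<and> c \<le> digit b (a i) j}"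
      by (rule bij_betwI[where g = "\<lambda>j. l - Suc j"]) (auto simp: Suc_diff_Suc)
    from bij_betw_same_card[OF this] assms i
    show "card {j. j < l \<and> c \<le> digit b (a i) (l - Suc j)} = W (a i)" by (simp add: W_eq assignment_def)
  qed
  finally show ?thesis by (simp add: weight_def)
qed

lemma suppression_is_mat_of:
  assumes "suppression D E"
  shows "\<exists>a. assignment a \<and> mat_of a = E"
proof -
  \<comment> \<open>Adding \<open>c\<close> marks the \<open>\<star>\<close> and retains the symbol,
    so that \<open>R\<close> recovers the row. Columns are reversed because digits count from the
    least significant one.\<close>
  define d where "d i j = (if E $$ (i, l - Suc j) = None then D $$ (i, l - Suc j) + c else D $$ (i, l - Suc j))" for i j
  have "\<forall>i. \<exists>u. i < n \<longrightarrow> u < U \<and> (\<forall>j<l. digit b u j = d i j)"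
  proof
    fix i
    have "d i j < b" if "i < n" "j < l" for j
      using D_less[of i "l - Suc j"] that by (auto simp: d_def b_def)
    then show "\<exists>u. i < n \<longrightarrow> u < U \<and> (\<forall>j<l. digit b u j = d i j)"
      using digits_exist[of l "d i" b] unfolding U_def by blast
  qed
  then obtain a where a: "\<And>i. i < n \<Longrightarrow> a i < U \<and> (\<forall>j<l. digit b (a i) j = d i j)" by metis
  have Dl: "D $$ (i, l - Suc j) < c" if "i < n" "j < l" for i j using D_less that by simp
  have "R (a i) = code i" if i: "i < n" for i
  proof (rule digits_eqI[where b = b and l = l])
    fix j assume j: "j < l"
    have "digit b (code i) (l - Suc (l - Suc j)) = D $$ (i, l - Suc j)"
      by (rule digit_code) (use i j in auto)
    moreover have "l - Suc (l - Suc j) = j" using j by simp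
    moreover have "d i j mod c = D $$ (i, l - Suc j)" using Dl[OF i j] by (simp add: d_def)
    ultimately show "digit b (R (a i)) j = digit b (code i) j"
      using a[OF i] j by (simp add: digit_R)
  qed (use a[OF i] R_less code_less i in \<open>auto simp: U_def[symmetric]\<close>)
  with a have "assignment a" by (simp add: assignment_def)
  moreover have "mat_of a = E"
  proof (rule eq_matI)
    fix i j assume "i < dim_row E" "j < dim_col E"
    with assms D have ij: "i < n" "j < l" by (auto simp: suppression_def)
    have "digit b (a i) (l - Suc j) = d i (l - Suc j)" using a[OF ij(1)] ij by simp
    also have "d i (l - Suc j) = (if E $$ (i, j) = None then D $$ (i, j) + c else D $$ (i, j))"
      using ij by (simp add: d_def Suc_diff_Suc)
    finally have "mat_of a $$ (i, j) = (if E $$ (i, j) = None then None else Some (D $$ (i, j)))"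
      using ij D_less[OF ij] by (simp add: mat_of_def Let_def)
    moreover have "E $$ (i, j) = None \<or> E $$ (i, j) = Some (D $$ (i, j))"
      using assms ij D by (simp add: suppression_def)
    ultimately show "mat_of a $$ (i, j) = E $$ (i, j)" by (auto split: if_splits)
  qed (use assms D in \<open>auto simp: mat_of_def suppression_def\<close>)
  ultimately show ?thesis by blast
qed

definition valid :: "(nat \<Rightarrow> nat) \<Rightarrow> bool" where
  "valid a \<longleftrightarrow> assignment a \<and> (\<forall>i<n. k \<le> card {i' \<in> {..<n}. P (a i') = P (a i)})"

text \<open>The definition of anonymity counts \<open>k - 1\<close> other rows, \<open>valid\<close>
  counts the row itself as well; rows agree exactly if their visible parts \<open>P\<close>
  do.\<close>

lemma k_anonymization_mat_of:
  assumes "assignment a"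
  shows "k_anonymization k D (mat_of a) \<longleftrightarrow> valid a"
proof -
  have d: "dim_row (mat_of a) = n" by (simp add: mat_of_def)
  have "k - 1 \<le> card {j. j < n \<and> j \<noteq> i \<and> row (mat_of a) j = row (mat_of a) i} \<longleftrightarrow>
      k \<le> card {i' \<in> {..<n}. P (a i') = P (a i)}" if i: "i < n" for i
  proof -
    have "{i' \<in> {..<n}. P (a i') = P (a i)} =
        insert i {j. j < n \<and> j \<noteq> i \<and> row (mat_of a) j = row (mat_of a) i}"
      using row_mat_of_eq_iff[OF assms _ i] i by auto
    then have "card {i' \<in> {..<n}. P (a i') = P (a i)} =
        Suc (card {j. j < n \<and> j \<noteq> i \<and> row (mat_of a) j = row (mat_of a) i})" by simp
    then show ?thesis by auto
  qed
  then show ?thesis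
    using suppression_mat_of[OF assms] assms
    unfolding k_anonymization_def k_anonymous_def valid_def d by auto
qed

definition "copies a u = card {i \<in> {..<n}. a i = u}"

text \<open>Removing the stars from \<open>k\<close> of the rows leaves at least \<open>k\<close> rows behind, and the \<open>k\<close> rows freed are
  equal to each other.\<close>

lemma release_rows:
  assumes "valid a" "u < U" "0 < W u" "K \<le> copies a u"
  shows "\<exists>a'. valid a' \<and> weight a' < weight a"
proof -
  from assms(4) have "k \<le> card {i \<in> {..<n}. a i = u}" by (simp add: copies_def K_def)
  then obtain S where S: "S \<subseteq> {i \<in> {..<n}. a i = u}" "card S = k" by (meson obtain_subset_with_card_n)
  have fS: "finite S" using S(1) by (rule finite_subset) simp
  define a' where "a' i = (if i \<in> S then R u else a i)" for i
  have u: "R (R u) = R u" "R u < U" "W (R u) = 0" using assms(2) R_idem R_less W_R by auto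
  have "assignment a" using assms(1) by (simp add: valid_def)
  then have asg: "assignment a'" using S(1) u by (auto simp: assignment_def a'_def)
  have Pu: "P u \<noteq> P (R u)" using P_R_neq assms(2,3) by blast
  have "k \<le> card {i' \<in> {..<n}. P (a' i') = P (a' i)}" if i: "i < n" for i
  proof -
    \<comment> \<open>The rows of \<open>S\<close> leave the group of \<open>P u\<close> for that of
      \<open>P (R u)\<close>. The first keeps \<open>K - k = k\<close> copies of \<open>u\<close>,
      the second contains all of \<open>S\<close>, and no other group loses a row.\<close>
    consider "P (a' i) = P u" | "P (a' i) = P (R u)" | "P (a' i) \<noteq> P u" "P (a' i) \<noteq> P (R u)" by blast
    then show ?thesis
    proof cases
      case 1
      have "k \<le> card ({i \<in> {..<n}. a i = u} - S)"
        using S assms(4) fS by (subst card_Diff_subset) (simp_all add: copies_def K_def)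
      also have "\<dots> \<le> card {i' \<in> {..<n}. P (a' i') = P u}"
        by (rule card_mono) (auto simp: a'_def)
      finally show ?thesis by (simp only: 1)
    next
      case 2
      have "k = card S" using S by simp
      also have "\<dots> \<le> card {i' \<in> {..<n}. P (a' i') = P (R u)}"
        by (rule card_mono) (use S in \<open>auto simp: a'_def\<close>)
      finally show ?thesis by (simp only: 2)
    next
      case 3
      then have "i \<notin> S" by (auto simp: a'_def)
      with assms(1) i have "k \<le> card {i' \<in> {..<n}. P (a i') = P (a' i)}" by (auto simp: valid_def a'_def)
      also have "\<dots> \<le> card {i' \<in> {..<n}. P (a' i') = P (a' i)}"
        by (rule card_mono) (use S 3 in \<open>auto simp: a'_def\<close>)
      finally show ?thesis .
    qed
  qed
  with asg have "valid a'" by (simp add: valid_def)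
  moreover have "weight a' < weight a"
    unfolding weight_def
  proof (rule sum_strict_mono_ex1)
    show "\<forall>i\<in>{..<n}. W (a' i) \<le> W (a i)" by (auto simp: a'_def u)
    from S k have "S \<noteq> {}" by auto
    then obtain i where "i \<in> S" by blast
    with S assms(3) show "\<exists>i\<in>{..<n}. W (a' i) < W (a i)" by (auto simp: a'_def u intro!: bexI[of _ i])
  qed simp
  ultimately show ?thesis by blast
qed

text \<open>A valid assignment of least weight cannot be improved by \<open>release_rows\<close>, so
  none of its starred copies occurs \<open>K\<close> times.\<close>

lemma valid_small:
  assumes "valid a"
  shows "\<exists>a'. valid a' \<and> weight a' \<le> weight a \<and> (\<forall>u<U. 0 < W u \<longrightarrow> copies a' u < K)"
proof -
  from ex_has_least_nat[of valid a weight] assms obtain a' where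
    "valid a'" "\<And>a''. valid a'' \<Longrightarrow> weight a' \<le> weight a''" by blast
  with release_rows[of a'] assms show ?thesis by (meson leD le_less_linear)
qed

definition "rows_with r = card {i \<in> {..<n}. code i = r}"

text \<open>The digits of \<open>z\<close> in base \<open>K\<close> prescribe how often each copy with a star is used; the remaining
  rows stay as they are.\<close>

definition "starred z r t = (\<Sum>v\<in>{v \<in> {..<t}. R v = r \<and> v \<noteq> r}. digit K z v)"

definition "config z u = (if R u = u then rows_with u - starred z u U else digit K z u)"

definition "group_size z p = (\<Sum>v\<in>{v \<in> {..<U}. P v = p}. config z v)"

definition "stars z = (\<Sum>v<U. digit K z v * W v)"

definition "sums_ok z \<longleftrightarrow> (\<forall>r<U. starred z r U \<le> rows_with r)"

definition "feasible z \<longleftrightarrow> sums_ok z \<and> (\<forall>p<U. group_size z p = 0 \<or> k \<le> group_size z p)"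

lemma group_eq:
  assumes "\<And>u. u < U \<Longrightarrow> copies a u = config z u" "assignment a"
  shows "group_size z p = card {i \<in> {..<n}. P (a i) = p}"
proof -
  have "group_size z p = (\<Sum>v\<in>{v \<in> {..<U}. P v = p}. card {i \<in> {..<n}. a i = v})"
    unfolding group_size_def by (intro sum.cong) (auto simp: assms(1)[symmetric] copies_def)
  also have "\<dots> = card {i \<in> {..<n}. a i \<in> {v \<in> {..<U}. P v = p}}"
    by (rule sum_card_fibres) auto
  also have "{i \<in> {..<n}. a i \<in> {v \<in> {..<U}. P v = p}} = {i \<in> {..<n}. P (a i) = p}"
    using assms(2) by (auto simp: assignment_def)
  finally show ?thesis .
qed

lemma weight_eq_stars:
  assumes "\<And>u. u < U \<Longrightarrow> copies a u = config z u" "assignment a"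
  shows "weight a = stars z"
proof -
  have "weight a = (\<Sum>u<U. card {i \<in> {..<n}. a i = u} * W u)"
    unfolding weight_def by (rule sum_fibres) (use assms(2) in \<open>auto simp: assignment_def\<close>)
  also have "\<dots> = stars z"
    unfolding stars_def
  proof (rule sum.cong[OF refl])
    fix u assume "u \<in> {..<U}"
    then show "card {i \<in> {..<n}. a i = u} * W u = digit K z u * W u"
      using assms(1)[of u] R_eq_self_iff[of u]
      by (cases "W u = 0") (auto simp: copies_def config_def)
  qed
  finally show ?thesis .
qed

lemma valid_if_feasible:
  assumes "\<And>u. u < U \<Longrightarrow> copies a u = config z u" "assignment a" "feasible z"
  shows "valid a"
  unfolding valid_def
proof (intro conjI allI impI)
  fix i assume i: "i < n"
  with assms(2) have "P (a i) < U" by (auto simp: assignment_def P_less)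
  with assms(3) have "group_size z (P (a i)) = 0 \<or> k \<le> group_size z (P (a i))" by (simp add: feasible_def)
  \<comment> \<open>Row \<open>i\<close> lies in its own group, which rules out the alternative of
    an empty group.\<close>
  moreover have "card {i' \<in> {..<n}. P (a i') = P (a i)} \<noteq> 0" using i by auto
  ultimately show "k \<le> card {i' \<in> {..<n}. P (a i') = P (a i)}"
    using group_eq[OF assms(1,2)] by metis
qed fact

text \<open>The digits of \<open>z\<close> are the multiplicities of the starred copies. Those of
  the star-free copies then agree by themselves: a row with code \<open>r\<close> that is not given
  a starred copy is given \<open>r\<close>.\<close>

lemma feasible_if_valid:
  assumes "valid a" "\<And>u. u < U \<Longrightarrow> 0 < W u \<Longrightarrow> copies a u < K"
  shows "\<exists>z < K ^ U. feasible z \<and> stars z = weight a"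
proof -
  have asg: "assignment a" using assms(1) by (simp add: valid_def)
  have "(if 0 < W u then copies a u else 0) < K" if "u < U" for u
    using assms(2)[OF that] k by (simp add: K_def)
  from digits_exist[of U "\<lambda>u. if 0 < W u then copies a u else 0" K] this
  obtain z where z: "z < K ^ U" "\<And>u. u < U \<Longrightarrow> digit K z u = (if 0 < W u then copies a u else 0)"
    by blast
  have st: "starred z r U = card {i \<in> {..<n}. code i = r \<and> a i \<noteq> r}" if "r < U" for r
  proof -
    have "starred z r U = (\<Sum>v\<in>{v \<in> {..<U}. R v = r \<and> v \<noteq> r}. card {i \<in> {..<n}. a i = v})"
      unfolding starred_def by (intro sum.cong) (auto simp: z(2) R_eq_self_iff[symmetric] copies_def)
    also have "\<dots> = card {i \<in> {..<n}. a i \<in> {v \<in> {..<U}. R v = r \<and> v \<noteq> r}}"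
      by (rule sum_card_fibres) auto
    also have "{i \<in> {..<n}. a i \<in> {v \<in> {..<U}. R v = r \<and> v \<noteq> r}} = {i \<in> {..<n}. code i = r \<and> a i \<noteq> r}"
      using asg by (auto simp: assignment_def)
    finally show ?thesis .
  qed
  have "sums_ok z"
    unfolding sums_ok_def rows_with_def
    using st by (auto intro!: card_mono)
  have cfg: "copies a u = config z u" if u: "u < U" for u
  proof (cases "R u = u")
    case True
    have "{i \<in> {..<n}. code i = u} - {i \<in> {..<n}. code i = u \<and> a i \<noteq> u} = {i \<in> {..<n}. a i = u}"
      using asg True by (auto simp: assignment_def)
    moreover have "card ({i \<in> {..<n}. code i = u} - {i \<in> {..<n}. code i = u \<and> a i \<noteq> u}) = config z u"
      using True st[OF u] by (subst card_Diff_subset) (auto simp: config_def rows_with_def)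
    ultimately show ?thesis by (simp add: copies_def)
  next
    case False
    then show ?thesis using u z(2)[OF u] R_eq_self_iff[OF u] by (simp add: config_def)
  qed
  have "group_size z p = 0 \<or> k \<le> group_size z p" for p
  proof (cases "\<exists>i<n. P (a i) = p")
    case True
    then show ?thesis using assms(1) group_eq[OF cfg asg] by (auto simp: valid_def)
  next
    case False
    then have "{i \<in> {..<n}. P (a i) = p} = {}" by auto
    then show ?thesis using group_eq[OF cfg asg] by (metis card.empty)
  qed
  with \<open>sums_ok z\<close> weight_eq_stars[OF cfg asg] z(1) show ?thesis by (auto simp: feasible_def)
qed

lemma feasible_if_k_anonymization:
  assumes "k_anonymization k D E"
  shows "\<exists>z < K ^ U. feasible z \<and> stars z \<le> cost E"
proof -
  from assms obtain a where a: "assignment a" "mat_of a = E"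
    using suppression_is_mat_of by (auto simp: k_anonymization_def)
  with assms have "valid a" using k_anonymization_mat_of by blast
  from valid_small[OF this] obtain a' where a': "valid a'" "weight a' \<le> weight a"
    "\<forall>u<U. 0 < W u \<longrightarrow> copies a' u < K" by blast
  from feasible_if_valid[OF a'(1)] a' cost_mat_of[OF a(1)] a(2) show ?thesis by auto
qed

text \<open>The criterion for the program: it has to find a cheapest feasible \<open>z\<close> and
  realize its multiplicities by any assignment whatsoever.\<close>

lemma optimal_mat_of:
  assumes "feasible z" "\<And>z'. z' < K ^ U \<Longrightarrow> feasible z' \<Longrightarrow> stars z \<le> stars z'"
    "assignment a" "\<And>u. u < U \<Longrightarrow> copies a u = config z u"
  shows "optimal_k_anonymization k D (mat_of a)"
  unfolding optimal_k_anonymization_def is_arg_min_def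
proof (intro conjI notI)
  show "k_anonymization k D (mat_of a)"
    using valid_if_feasible[OF assms(4,3,1)] k_anonymization_mat_of[OF assms(3)] by simp
  assume "\<exists>E. k_anonymization k D E \<and> cost E < cost (mat_of a)"
  then obtain E where E: "k_anonymization k D E" "cost E < cost (mat_of a)" by blast
  from feasible_if_k_anonymization[OF E(1)] assms(2) have "stars z \<le> cost E" by (meson le_trans)
  with E(2) weight_eq_stars[OF assms(4,3)] cost_mat_of[OF assms(3)] show False by simp
qed

text \<open>The distribution of copies over the rows of kind \<open>r\<close> neither runs out nor
  leaves anything over.\<close>

lemma sum_config:
  assumes "sums_ok z" "r < U" "R r = r"
  shows "(\<Sum>u\<in>{u \<in> {..<U}. R u = r}. config z u) = rows_with r"
proof -
  have "{u \<in> {..<U}. R u = r} = insert r {v \<in> {..<U}. R v = r \<and> v \<noteq> r}" using assms by auto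
  moreover have "(\<Sum>u\<in>{v \<in> {..<U}. R v = r \<and> v \<noteq> r}. config z u) = starred z r U"
    unfolding starred_def by (intro sum.cong) (auto simp: config_def)
  ultimately show ?thesis using assms by (simp add: config_def sums_ok_def)
qed

lemma K: "0 < K" "4 \<le> K" using k by (auto simp: K_def)

lemma l_less_U: "l < U"
proof -
  have "l < 2 ^ l" by (rule less_exp)
  also have "(2 :: nat) ^ l \<le> U" unfolding U_def using b by (intro power_mono) auto
  finally show ?thesis .
qed

lemma b_le_U: "b \<le> U"
  unfolding U_def using b l by (simp add: self_le_power)

lemma U_le_configs: "U \<le> K ^ U"
proof -
  have "(2 :: nat) ^ U \<le> K ^ U" using K by (intro power_mono) auto
  moreover have "U < 2 ^ U" by (rule less_exp)
  ultimately show ?thesis by linarith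
qed

lemma K_le_configs: "K \<le> K ^ U"
  using K U0 by (simp add: self_le_power)

text \<open>The exponent of the theorem: \<open>2 * k \<le> k\<^sup>2\<close> for
  \<open>k \<ge> 2\<close>, and \<open>k\<^sup>2\<close> is at most \<open>2 ^ k\<^sup>2\<close>,
  which is raised to the power \<open>U\<close>.\<close>

lemma configs_le: "K ^ U \<le> 2 ^ (k\<^sup>2 * (2 * c) ^ l)"
proof -
  have "K \<le> k\<^sup>2" using k by (simp add: K_def power2_eq_square)
  also have "\<dots> \<le> 2 ^ k\<^sup>2" using less_exp[of "k\<^sup>2"] by (rule less_imp_le)
  finally have "K ^ U \<le> (2 ^ k\<^sup>2) ^ U" by (rule power_mono) simp
  then show ?thesis by (simp add: power_mult U_def b_def)
qed

end

section \<open>The program\<close>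

abbreviation seq_syntax :: "com \<Rightarrow> com \<Rightarrow> com" (infixr ";;" 60) where
  "p ;; q \<equiv> Seq p q"

text \<open>Each factor is multiplied in by \<open>x\<close>-fold addition, hence a cost
  proportional to the exponent times the base.\<close>

definition Pow :: "string \<Rightarrow> string \<Rightarrow> string \<Rightarrow> com" where
  "Pow d x e = Seq (Assign d (Const 1)) (For ''i'' e
     (Seq (Assign ''v'' (Const 0))
     (Seq (For ''j'' x (Assign ''v'' (Add (Reg ''v'') (Reg d))))
       (Assign d (Reg ''v'')))))"

lemma mod_Pow [simp]: "mod_regs (Pow d x e) = {d, ''i'', ''v'', ''j''}" "mod_mem (Pow d x e) = {}"
  by (auto simp: Pow_def)

lemma wp_Pow:
  assumes vars: "{d, x, e} \<inter> {''i'', ''j'', ''v''} = {}" "d \<notin> {x, e}"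
    and B: "regs s x = B" "regs s e = m" "B ^ m < 2 ^ w" "1 \<le> B"
  shows "wp w (Pow d x e) (\<lambda>t s'. regs s' d = B ^ m \<and> t \<le> 8 + m * (18 + 12 * B)) 0 s"
proof -
  have w: "1 < (2 :: nat) ^ w" using B(3,4) by (metis le_less_trans one_le_power)
  have le: "B ^ j \<le> B ^ m" if "j \<le> m" for j using that B(4) by (simp add: power_increasing)
  have inner: "wp w (For ''j'' x (Assign ''v'' (Add (Reg ''v'') (Reg d))))
      (\<lambda>t s''. regs s'' ''v'' = B ^ Suc j \<and> t \<le> 6 + 12 * B) 0 s'"
    if "j < m" "regs s' x = B" "regs s' d = B ^ j" "regs s' ''v'' = 0" for j s'
  proof (rule wp_For[where N = B and I = "\<lambda>i t s''. regs s'' ''v'' = i * B ^ j \<and> t = 12 * i"])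
    fix i t s'' assume *: "i < B" "regs s'' ''v'' = i * B ^ j \<and> t = 12 * i"
      "same (insert ''j'' (mod_regs (Assign ''v'' (Add (Reg ''v'') (Reg d)))))
        (mod_mem (Assign ''v'' (Add (Reg ''v'') (Reg d)))) s' s''"
    have d: "regs s'' d = B ^ j" using sameR[OF *(3), of d] vars that by auto
    \<comment> \<open>Partial sums stay below the next power, hence below the final one, which
      fits.\<close>
    have "Suc i * B ^ j \<le> B * B ^ j" using *(1) by (intro mult_right_mono) auto
    also have "\<dots> < 2 ^ w" using le[of "Suc j"] that(1) B(3) by simp
    finally show "wp w (Assign ''v'' (Add (Reg ''v'') (Reg d)))
      (\<lambda>t s'''. regs (setr ''j'' (Suc i) s''') ''v'' = Suc i * B ^ j \<and> t + 8 = 12 * Suc i) t s''"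
      using * d by (simp add: add.commute)
  qed (use vars that in auto)
  let ?p = "Seq (Assign ''v'' (Const 0))
     (Seq (For ''j'' x (Assign ''v'' (Add (Reg ''v'') (Reg d)))) (Assign d (Reg ''v'')))"
  have main: "wp w (For ''i'' e ?p) (\<lambda>t s''. regs s'' d = B ^ m \<and> t \<le> 6 + m * (18 + 12 * B)) 0 s'"
    if "regs s' d = 1" "regs s' x = B" "regs s' e = m" for s'
  proof (rule wp_For[where N = m and I = "\<lambda>j t s'. regs s' d = B ^ j \<and> t \<le> j * (18 + 12 * B)"])
    fix j t s''
    assume *: "j < m" "regs s'' d = B ^ j \<and> t \<le> j * (18 + 12 * B)"
      "same (insert ''i'' (mod_regs ?p)) (mod_mem ?p) s' s''"
    have "regs s'' x = B" using sameR[OF *(3), of x] vars that by auto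
    then show "wp w ?p (\<lambda>t s0. regs (setr ''i'' (Suc j) s0) d = B ^ Suc j \<and>
        t + 8 \<le> Suc j * (18 + 12 * B)) t s''"
      using * vars w by (auto intro!: wp_conseq[OF inner[OF *(1)]])
  qed (use vars that in auto)
  show ?thesis
    unfolding Pow_def using vars B w by (auto intro!: wp_conseq[OF main])
qed

text \<open>The tables are filled by recursion on \<open>u = q * b + d\<close>. For \<open>u = 0\<close> also \<open>q = 0\<close>, and the entry read is
  the initial zero of the memory, which is its final value.\<close>

abbreviation Tables_body :: com where
  "Tables_body \<equiv>
    Store ''M'' (Reg ''u'') (Reg ''m'') ;;
    Assign ''m'' (Add (Reg ''m'') (Reg ''b'')) ;;
    Store ''Q'' (Reg ''u'') (Reg ''q'') ;;
    Cond (Sub (Reg ''c'') (Reg ''d''))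
      (Store ''R'' (Reg ''u'') (Add (Load ''M'' (Load ''R'' (Reg ''q''))) (Reg ''d'')) ;;
       Store ''P'' (Reg ''u'') (Add (Load ''M'' (Load ''P'' (Reg ''q''))) (Reg ''d'')) ;;
       Store ''W'' (Reg ''u'') (Load ''W'' (Reg ''q'')) ;;
       Store ''G'' (Reg ''u'') (Reg ''d''))
      (Store ''R'' (Reg ''u'') (Add (Load ''M'' (Load ''R'' (Reg ''q''))) (Sub (Reg ''d'') (Reg ''c''))) ;;
       Store ''P'' (Reg ''u'') (Add (Load ''M'' (Load ''P'' (Reg ''q''))) (Reg ''c'')) ;;
       Store ''W'' (Reg ''u'') (Add (Load ''W'' (Reg ''q'')) (Const 1)) ;;
       Store ''G'' (Reg ''u'') (Reg ''c'')) ;;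
    Assign ''d'' (Add (Reg ''d'') (Const 1)) ;;
    Cond (Sub (Reg ''b'') (Reg ''d''))
      Skip
      (Assign ''d'' (Const 0) ;; Assign ''q'' (Add (Reg ''q'') (Const 1)))"

definition Tables :: com where
  "Tables = Assign ''q'' (Const 0) ;; Assign ''d'' (Const 0) ;; Assign ''m'' (Const 0) ;;
     For ''u'' ''U'' Tables_body"

lemma mod_Tables [simp]: "mod_regs Tables = {''q'', ''d'', ''m'', ''u''}"
  "mod_mem Tables = {''M'', ''Q'', ''R'', ''P'', ''W'', ''G''}"
  by (auto simp: Tables_def)

text \<open>All values computed are at most \<open>H ^ 4\<close>.\<close>

locale ram = database +
  fixes w H :: nat
  assumes H: "n \<le> H" "n * l \<le> H" "U \<le> H" "K \<le> H" "K ^ U \<le> H" "l \<le> H" "b \<le> H" "2 \<le> H"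
    and w: "H ^ 4 < 2 ^ w"
begin

lemma cH: "c \<le> H" "k \<le> H" using H by (auto simp: b_def K_def)

lemma fits4: "x \<le> H * (H * (H * H)) \<Longrightarrow> x < 2 ^ w"
  using w by (simp add: numeral_eq_Suc)

lemma HH: "H \<le> H * H" "H * H \<le> H * (H * H)" "H * (H * H) \<le> H * (H * (H * H))" "2 * H \<le> H * H"
  using H(8) by auto

lemma fits1: "x \<le> H \<Longrightarrow> x < 2 ^ w" and fits2: "x \<le> 2 * H \<Longrightarrow> x < 2 ^ w"
proof -
  have "x \<le> H \<Longrightarrow> x \<le> 2 * H" "x \<le> 2 * H \<Longrightarrow> x \<le> H * (H * (H * H))"
    using HH by linarith+
  then show "x \<le> H \<Longrightarrow> x < 2 ^ w" "x \<le> 2 * H \<Longrightarrow> x < 2 ^ w"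
    using fits4 by blast+
qed

lemma fitsHH: "x \<le> H * H \<Longrightarrow> x < 2 ^ w" and fitsHHH: "x \<le> H * (H * H) \<Longrightarrow> x < 2 ^ w"
  using HH fits4 by (meson order.trans)+

lemma fits_consts [simp]: "Suc 0 < 2 ^ w" "0 < w" 
  using fits1[of 1] H(8) by (auto intro: gr0I)

definition "params s \<longleftrightarrow> regs s ''n'' = n \<and> regs s ''l'' = l \<and> regs s ''c'' = c \<and> regs s ''k'' = k \<and>
  regs s ''b'' = b \<and> regs s ''K'' = K \<and> regs s ''U'' = U"

text \<open>\<open>M\<close> and \<open>Q\<close> stand in for multiplication and division by
  \<open>b\<close>; \<open>G\<close> is the visible last digit, used to write out rows.\<close>

definition "tables s \<longleftrightarrow> params s \<and> (\<forall>u<U. mem s ''M'' u = u * b \<and> mem s ''Q'' u = u div b \<and>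
  mem s ''R'' u = R u \<and> mem s ''P'' u = P u \<and> mem s ''W'' u = W u \<and> mem s ''G'' u = min c (u mod b))"

lemma params_same:
  "params s \<Longrightarrow> same X Y s s' \<Longrightarrow> X \<inter> {''n'', ''l'', ''c'', ''k'', ''b'', ''K'', ''U''} = {} \<Longrightarrow> params s'"
  by (auto simp: params_def same_def)

lemma tables_same:
  "tables s \<Longrightarrow> same X Y s s' \<Longrightarrow> X \<inter> {''n'', ''l'', ''c'', ''k'', ''b'', ''K'', ''U''} = {} \<Longrightarrow>
    Y \<inter> {''M'', ''Q'', ''R'', ''P'', ''W'', ''G''} = {} \<Longrightarrow> tables s'"
  using params_same unfolding tables_def by (auto simp: same_def)

lemma params_set [simp]:
  "r \<notin> {''n'', ''l'', ''c'', ''k'', ''b'', ''K'', ''U''} \<Longrightarrow> params (setr r v s) = params s"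
  "params (setm a i v s) = params s"
  by (auto simp: params_def)

lemma tables_set [simp]:
  "r \<notin> {''n'', ''l'', ''c'', ''k'', ''b'', ''K'', ''U''} \<Longrightarrow> tables (setr r v s) = tables s"
  "a \<notin> {''M'', ''Q'', ''R'', ''P'', ''W'', ''G''} \<Longrightarrow> tables (setm a i v s) = tables s"
proof -
  have *: "same {r} {} s (setr r v s)" "same {r} {} (setr r v s) s"
    "same {} {a} s (setm a i v s)" "same {} {a} (setm a i v s) s" by (simp_all add: same_def)
  show "tables (setr r v s) = tables s" if "r \<notin> {''n'', ''l'', ''c'', ''k'', ''b'', ''K'', ''U''}"
    using tables_same[OF _ *(1)] tables_same[OF _ *(2)] that by (intro iffI) auto
  show "tables (setm a i v s) = tables s" if "a \<notin> {''M'', ''Q'', ''R'', ''P'', ''W'', ''G''}"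
    using tables_same[OF _ *(3)] tables_same[OF _ *(4)] that by (intro iffI) auto
qed

lemma R_le: "R u \<le> u" and P_le: "P u \<le> u"
  unfolding R_def P_def by (auto intro!: map_digits_le)

lemma R_rec: "R u = R (u div b) * b + u mod b mod c"
  unfolding R_def by (rule map_digits_rec) (use b in auto)

lemma P_rec: "P u = P (u div b) * b + min c (u mod b)"
  unfolding P_def by (rule map_digits_rec) (use b in auto)

lemma W_rec: "W u = W (u div b) + (if u mod b < c then 0 else 1)"
  unfolding W_def by (rule sum_digits_rec) (use b c in auto)

lemma W_le: "u < U \<Longrightarrow> W u \<le> l"
  by (simp add: W_eq) (rule order.trans[OF card_mono[of "{..<l}"]], auto)

lemma wp_Tables:
  assumes "params s" "mem s ''R'' 0 = 0" "mem s ''P'' 0 = 0" "mem s ''W'' 0 = 0"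
  shows "wp w Tables (\<lambda>t s'. tables s' \<and> t \<le> 12 + 80 * U) 0 s"
proof -
  have 0: "R 0 = 0" "P 0 = 0" "W 0 = 0"
    using R_le[of 0] P_le[of 0] by (auto simp: W_def sum_digits.simps[of b _ 0])
  let ?I = "\<lambda>j t s'. t \<le> 80 * j \<and>
    regs s' ''q'' = j div b \<and> regs s' ''d'' = j mod b \<and> regs s' ''m'' = j * b \<and>
    (\<forall>u<j. mem s' ''M'' u = u * b \<and> mem s' ''Q'' u = u div b \<and> mem s' ''G'' u = min c (u mod b)) \<and>
    (\<forall>u. u < j \<or> u = 0 \<longrightarrow> mem s' ''R'' u = R u \<and> mem s' ''P'' u = P u \<and> mem s' ''W'' u = W u)"
  have main: "wp w (For ''u'' ''U'' Tables_body) (\<lambda>t s''. tables s'' \<and> t \<le> 6 + 80 * U) 0 s'"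
    if "params s'" "?I 0 0 s'" for s'
  proof (rule wp_For[where N = U and I = ?I])
    fix j t s''
    assume j: "j < U" and I: "?I j t s''" and u: "regs s'' ''u'' = j"
      and f: "same (insert ''u'' (mod_regs Tables_body)) (mod_mem Tables_body) s' s''"
    have pr: "regs s'' ''b'' = b" "regs s'' ''c'' = c"
      using sameR[OF f] that(1) by (simp_all add: params_def)
    let ?q = "j div b" and ?d = "j mod b"
    have "?q < j \<or> ?q = 0" using div_less_dividend[of b j] b(1) by (cases "j = 0") simp_all
    then have q: "?q < j \<or> ?q = 0" "?q \<le> j" by auto
    then have rq: "mem s'' ''R'' ?q = R ?q" "mem s'' ''P'' ?q = P ?q" "mem s'' ''W'' ?q = W ?q"
      using I by auto
    have "R ?q \<le> j" "P ?q \<le> j" using order.trans[OF R_le q(2)] order.trans[OF P_le q(2)] by auto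
    \<comment> \<open>Entry \<open>j\<close> of \<open>M\<close> has been stored earlier in this
      very round. It is read back only for \<open>j = 0\<close>, since otherwise \<open>R ?q\<close>
      and \<open>P ?q\<close> are at most \<open>?q < j\<close>.\<close>
    then have M: "(if R ?q = j then j * b else mem s'' ''M'' (R ?q)) = R ?q * b"
      "(if P ?q = j then j * b else mem s'' ''M'' (P ?q)) = P ?q * b"
      using I by auto
    have d: "?d < b" using b by simp
    \<comment> \<open>As \<open>?d < 2 * c\<close>, reduction modulo \<open>c\<close> is at most one
      subtraction.\<close>
    have Rj: "R j = R ?q * b + (if ?d < c then ?d else ?d - c)"
    proof -
      have "?d mod c = (if ?d < c then ?d else ?d - c)" using d by (auto simp: b_def le_mod_geq not_less)
      then show ?thesis by (simp add: R_rec[of j])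
    qed
    have Pj: "P j = P ?q * b + (if ?d < c then ?d else c)"
      by (simp add: P_rec[of j])
    have Wj: "W j = W ?q + (if ?d < c then 0 else 1)"
      by (simp add: W_rec[of j])
    have RPU: "R j < U" "P j < U" "W j \<le> l" using R_less P_less W_le j by auto
    have safe: "j * b + b < 2 ^ w" "R j < 2 ^ w" "P j < 2 ^ w" "W j < 2 ^ w" "Suc ?d < 2 ^ w" "Suc ?q < 2 ^ w" "b < 2 ^ w"
    proof -
      have "Suc j * b \<le> H * H" using j H by (intro mult_mono) auto
      then show "j * b + b < 2 ^ w" by (intro fitsHH) simp
    qed (use RPU H d q j in \<open>auto intro!: fits1\<close>)
    show "wp w Tables_body (\<lambda>t s0. ?I (Suc j) (t + 8) (setr ''u'' (Suc j) s0)) t s''"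
    proof (cases "?d < c")
      case True
      have "R ?q * b + ?d = R j" "P ?q * b + ?d = P j" "W ?q = W j"
        using True Rj Pj Wj by simp_all
      note facts = I u pr rq M safe d this True
      show ?thesis
        by (cases "Suc ?d = b"; simp add: facts div_Suc mod_Suc; insert b(1) c d I[THEN conjunct1] True; auto)
    next
      case False
      have "R ?q * b + (?d - c) = R j" "P ?q * b + c = P j" "Suc (W ?q) = W j"
        using False Rj Pj Wj by simp_all
      note facts = I u pr rq M safe d this False
      show ?thesis
        by (cases "Suc ?d = b"; simp add: facts div_Suc mod_Suc; insert b(1) c d I[THEN conjunct1] False; auto)
    qed
  next
    fix t s''
    assume I: "?I U t s''" and f: "same (insert ''u'' (mod_regs Tables_body)) (mod_mem Tables_body) s' s''"
    have "params s''" using params_same[OF that(1) f] by simp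
    with I show "tables s'' \<and> t + 6 \<le> 6 + 80 * U" by (auto simp: tables_def)
  qed (use that in \<open>auto simp: params_def\<close>)
  show ?thesis
    unfolding Tables_def by simp (rule wp_conseq[OF main]; use assms 0 in simp)
qed

end

section \<open>Reading the rows and evaluating one choice of multiplicities\<close>

abbreviation Read_row :: com where
  "Read_row \<equiv>
    Assign ''r'' (Add (Load ''M'' (Reg ''r'')) (Load ''D'' (Reg ''a''))) ;;
    Assign ''a'' (Add (Reg ''a'') (Const 1))"

abbreviation Read_body :: com where
  "Read_body \<equiv> Assign ''r'' (Const 0) ;; For ''j'' ''l'' Read_row ;;
    Store ''C'' (Reg ''i'') (Reg ''r'') ;;
    Store ''N'' (Reg ''r'') (Add (Load ''N'' (Reg ''r'')) (Const 1))"

text \<open>\<open>a\<close> is never reset between rows: one scan of the input in row-major order,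
  each entry costing one Horner step whose product is looked up in \<open>M\<close>.\<close>

definition Read :: com where
  "Read = Assign ''a'' (Const 0) ;; For ''i'' ''n'' Read_body"

lemma mod_Read [simp]: "mod_regs Read = {''a'', ''r'', ''j'', ''i''}" "mod_mem Read = {''C'', ''N''}"
  by (auto simp: Read_def)

text \<open>Division by repeated subtraction. The truncated difference \<open>y + 1 - K\<close> is
  nonzero exactly if \<open>K \<le> y\<close>.\<close>

abbreviation Div_loop :: com where
  "Div_loop \<equiv> While (Sub (Add (Reg ''y'') (Const 1)) (Reg ''K''))
    (Assign ''y'' (Sub (Reg ''y'') (Reg ''K'')) ;; Assign ''q'' (Add (Reg ''q'') (Const 1)))"

abbreviation Cost_loop :: com where
  "Cost_loop \<equiv> For ''j'' ''y'' (Assign ''s'' (Add (Reg ''s'') (Load ''W'' (Reg ''u''))))"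

text \<open>\<open>y\<close> holds the digits of \<open>z\<close> not yet consumed; after the
  division it is the current digit and \<open>q\<close> the rest. That \<open>r\<close> and
  \<open>u\<close> differ is tested by adding both truncated differences. A star-free copy comes
  before the starred copies of the same row, so \<open>X[r]\<close> has been set to
  \<open>N[r]\<close> by the time they draw from it.\<close>

abbreviation Decode_body :: com where
  "Decode_body \<equiv> Assign ''q'' (Const 0) ;; Div_loop ;;
    Assign ''r'' (Load ''R'' (Reg ''u'')) ;;
    Cond (Add (Sub (Reg ''r'') (Reg ''u'')) (Sub (Reg ''u'') (Reg ''r'')))
      (Store ''X'' (Reg ''u'') (Reg ''y'') ;;
       Cond (Sub (Reg ''y'') (Load ''X'' (Reg ''r''))) (Assign ''o'' (Const 0)) Skip ;;
       Store ''X'' (Reg ''r'') (Sub (Load ''X'' (Reg ''r'')) (Reg ''y'')) ;;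
       Cost_loop)
      (Store ''X'' (Reg ''u'') (Load ''N'' (Reg ''u''))) ;;
    Assign ''y'' (Reg ''q'')"

abbreviation Sizes_body :: com where
  "Sizes_body \<equiv> Store ''F'' (Load ''P'' (Reg ''u''))
    (Add (Load ''F'' (Load ''P'' (Reg ''u''))) (Load ''X'' (Reg ''u'')))"

abbreviation Check_body :: com where
  "Check_body \<equiv> Cond (Load ''F'' (Reg ''u''))
    (Cond (Sub (Reg ''k'') (Load ''F'' (Reg ''u''))) (Assign ''o'' (Const 0)) Skip) Skip"

definition Decode :: com where
  "Decode = For ''u'' ''U'' Decode_body"

definition Clear :: com where
  "Clear = For ''u'' ''U'' (Store ''F'' (Reg ''u'') (Const 0))"

definition Sizes :: com where
  "Sizes = For ''u'' ''U'' Sizes_body"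

definition Check :: com where
  "Check = For ''u'' ''U'' Check_body"

definition Evaluate :: com where
  "Evaluate = Assign ''o'' (Const 1) ;; Assign ''s'' (Const 0) ;; Assign ''y'' (Reg ''z'') ;;
     Decode ;; Clear ;; Sizes ;; Check"

lemma mod_Evaluate_parts [simp]:
  "mod_regs Decode = {''u'', ''q'', ''y'', ''r'', ''o'', ''j'', ''s''}" "mod_mem Decode = {''X''}"
  "mod_regs Clear = {''u''}" "mod_mem Clear = {''F''}"
  "mod_regs Sizes = {''u''}" "mod_mem Sizes = {''F''}"
  "mod_regs Check = {''u'', ''o''}" "mod_mem Check = {}"
  by (auto simp: Decode_def Clear_def Sizes_def Check_def)

lemma mod_Evaluate [simp]: "mod_regs Evaluate = {''u'', ''q'', ''y'', ''r'', ''o'', ''j'', ''s''}"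
  "mod_mem Evaluate = {''X'', ''F''}"
  by (auto simp: Evaluate_def)

context ram
begin

definition "loaded s \<longleftrightarrow> tables s \<and> (\<forall>i<n. mem s ''C'' i = code i) \<and> (\<forall>u. mem s ''N'' u = rows_with u)"

lemma loaded_same:
  "loaded s \<Longrightarrow> same X Y s s' \<Longrightarrow> X \<inter> {''n'', ''l'', ''c'', ''k'', ''b'', ''K'', ''U''} = {} \<Longrightarrow>
    Y \<inter> {''M'', ''Q'', ''R'', ''P'', ''W'', ''G'', ''C'', ''N''} = {} \<Longrightarrow> loaded s'"
  using tables_same unfolding loaded_def by (auto simp: same_def)

lemma loaded_set [simp]:
  "r \<notin> {''n'', ''l'', ''c'', ''k'', ''b'', ''K'', ''U''} \<Longrightarrow> loaded (setr r v s) = loaded s"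
  "a \<notin> {''M'', ''Q'', ''R'', ''P'', ''W'', ''G'', ''C'', ''N''} \<Longrightarrow> loaded (setm a i v s) = loaded s"
proof -
  have *: "same {r} {} s (setr r v s)" "same {r} {} (setr r v s) s"
    "same {} {a} s (setm a i v s)" "same {} {a} (setm a i v s) s" by (simp_all add: same_def)
  show "loaded (setr r v s) = loaded s" if "r \<notin> {''n'', ''l'', ''c'', ''k'', ''b'', ''K'', ''U''}"
    using loaded_same[OF _ *(1)] loaded_same[OF _ *(2)] that by (intro iffI) auto
  show "loaded (setm a i v s) = loaded s" if "a \<notin> {''M'', ''Q'', ''R'', ''P'', ''W'', ''G'', ''C'', ''N''}"
    using loaded_same[OF _ *(3)] loaded_same[OF _ *(4)] that by (intro iffI) auto
qed

lemma wp_Read_row: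
  assumes "tables s" "i < n" "regs s ''a'' = i * l" "regs s ''r'' = 0"
    "\<forall>x<n * l. mem s ''D'' x = D $$ (x div l, x mod l)"
  shows "wp w (For ''j'' ''l'' Read_row)
    (\<lambda>t s'. regs s' ''r'' = code i \<and> regs s' ''a'' = l + i * l \<and> t \<le> 6 + 18 * l) 0 s"
proof (rule wp_For[where N = l and
    I = "\<lambda>j t s'. regs s' ''r'' = horner i j \<and> regs s' ''a'' = i * l + j \<and> t = 18 * j"])
  fix j t s'
  assume j: "j < l" and I: "regs s' ''r'' = horner i j \<and> regs s' ''a'' = i * l + j \<and> t = 18 * j"
    and f: "same (insert ''j'' (mod_regs Read_row)) (mod_mem Read_row) s s'"
  have "horner i j < b ^ j" using horner_less[of i j] assms(2) j by simp
  also have "\<dots> < U" unfolding U_def using b j by (intro power_strict_increasing) auto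
  finally have "horner i j < U" .
  then have M: "mem s' ''M'' (horner i j) = horner i j * b"
    using tables_same[OF assms(1) f] by (simp add: tables_def)
  have "Suc i * l \<le> n * l" using assms(2) by (intro mult_right_mono) auto
  then have a: "i * l + j < n * l" using j by simp
  then have D: "mem s' ''D'' (i * l + j) = D $$ (i, j)"
    using sameM[OF f] assms(5) j by simp
  have "horner i (Suc j) < b ^ Suc j" using horner_less[of i "Suc j"] assms(2) j by simp
  also have "\<dots> \<le> U" unfolding U_def using b j by (intro power_increasing) auto
  finally have safe: "horner i j * b + D $$ (i, j) < 2 ^ w" "Suc (i * l + j) < 2 ^ w"
    using H a by (auto intro!: fits1)
  show "wp w Read_row (\<lambda>t s0. regs (setr ''j'' (Suc j) s0) ''r'' = horner i (Suc j) \<and>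
      regs (setr ''j'' (Suc j) s0) ''a'' = i * l + Suc j \<and> t + 8 = 18 * Suc j) t s'"
    by (simp add: I M D safe)
qed (use assms in \<open>auto simp: tables_def params_def code_def\<close>)

definition "rows_before i u = card {i' \<in> {..<i}. code i' = u}"

lemma rows_before_Suc: "rows_before (Suc i) u = (if code i = u then Suc (rows_before i u) else rows_before i u)"
proof -
  have "{i' \<in> {..<Suc i}. code i' = u} =
      (if code i = u then insert i {i' \<in> {..<i}. code i' = u} else {i' \<in> {..<i}. code i' = u})"
    by (auto simp: less_Suc_eq)
  then show ?thesis by (auto simp: rows_before_def)
qed

lemma rows_before_le: "rows_before i u \<le> i"
  unfolding rows_before_def by (rule order.trans[OF card_mono[of "{..<i}"]]) auto

lemma rows_before_n: "rows_before n u = rows_with u" and rows_before_0: "rows_before 0 u = 0"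
  by (simp_all add: rows_before_def rows_with_def)

lemma wp_Read:
  assumes "tables s" "\<forall>x<n * l. mem s ''D'' x = D $$ (x div l, x mod l)" "\<forall>u. mem s ''N'' u = 0"
  shows "wp w Read (\<lambda>t s'. loaded s' \<and> t \<le> 8 + n * (25 + 18 * l)) 0 s"
proof -
  let ?I = "\<lambda>i t s'. regs s' ''a'' = i * l \<and> (\<forall>i'<i. mem s' ''C'' i' = code i') \<and>
    (\<forall>u. mem s' ''N'' u = rows_before i u) \<and> t \<le> i * (25 + 18 * l)"
  have main: "wp w (For ''i'' ''n'' Read_body) (\<lambda>t s''. loaded s'' \<and> t \<le> 6 + n * (25 + 18 * l)) 0 s'"
    if s': "tables s'" "\<forall>x<n * l. mem s' ''D'' x = D $$ (x div l, x mod l)"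
      "\<forall>u. mem s' ''N'' u = 0" "regs s' ''a'' = 0" for s'
  proof (rule wp_For[where N = n and I = ?I])
    fix i t s''
    assume i: "i < n" and I: "?I i t s''" and r: "regs s'' ''i'' = i"
      and f: "same (insert ''i'' (mod_regs Read_body)) (mod_mem Read_body) s' s''"
    have tab: "tables s''" using tables_same[OF s'(1) f] by simp
    have D: "mem s'' ''D'' = mem s' ''D''" using sameM[OF f] by simp
    have safe: "Suc (rows_before i (code i)) < 2 ^ w" "code i < 2 ^ w"
      using i H code_less[OF i] rows_before_le[of i "code i"] by (auto intro!: fits1)
    have "tables (setr ''r'' 0 s'')" using tab by (simp add: tables_def params_def)
    note row = wp_Read_row[OF this i]
    show "wp w Read_body (\<lambda>t s0. ?I (Suc i) (t + 8) (setr ''i'' (Suc i) s0)) t s''"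
      apply simp
      apply (rule wp_conseq[OF row])
         apply (simp_all add: I s' D)
      subgoal for t' s0
        using sameR[of _ _ "setr ''r'' 0 s''" s0] sameM[of _ _ "setr ''r'' 0 s''" s0] I
        by (auto simp: safe r rows_before_Suc less_Suc_eq algebra_simps)
      done
  next
    fix t s''
    assume I: "?I n t s''" and f: "same (insert ''i'' (mod_regs Read_body)) (mod_mem Read_body) s' s''"
    have "tables s''" using tables_same[OF s'(1) f] by simp
    with I show "loaded s'' \<and> t + 6 \<le> 6 + n * (25 + 18 * l)" by (simp add: loaded_def rows_before_n)
  qed (use s' in \<open>auto simp: rows_before_0 tables_def params_def\<close>)
  show ?thesis
    unfolding Read_def by simp (rule wp_conseq[OF main]; use assms in simp)
qed

lemma starred_Suc: "starred z r (Suc j) = starred z r j + (if R j = r \<and> j \<noteq> r then digit K z j else 0)"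
proof -
  have "{v \<in> {..<Suc j}. R v = r \<and> v \<noteq> r} = (if R j = r \<and> j \<noteq> r
    then insert j {v \<in> {..<j}. R v = r \<and> v \<noteq> r} else {v \<in> {..<j}. R v = r \<and> v \<noteq> r})"
    by (auto simp: less_Suc_eq)
  then show ?thesis by (simp add: starred_def)
qed

text \<open>By \<open>R v \<le> v\<close> every starred copy of \<open>r\<close> has a number above
  \<open>r\<close>, so nothing is drawn from \<open>r\<close> before it is initialized.\<close>

lemma starred_eq_0: "j \<le> r \<Longrightarrow> starred z r j = 0"
proof -
  assume "j \<le> r"
  then have "R v \<noteq> r" if "v < j" for v using that R_le[of v] by linarith
  then have "{v \<in> {..<j}. R v = r \<and> v \<noteq> r} = {}" by auto
  then show ?thesis by (simp only: starred_def sum.empty)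
qed

text \<open>The content of \<open>X[v]\<close> for \<open>v < j\<close> when the copies below
  \<open>j\<close> have been processed: only these have been subtracted so far.\<close>

definition "partial z j v = (if R v = v then rows_with v - starred z v j else digit K z v)"

lemma partial_U: "partial z U v = config z v"
  by (simp add: partial_def config_def)

definition "stars_below z j = (\<Sum>v<j. digit K z v * W v)"

lemma stars_below_Suc: "stars_below z (Suc j) = stars_below z j + digit K z j * W j"
  and stars_below_0: "stars_below z 0 = 0" and stars_below_U: "stars_below z U = stars z"
  by (simp_all add: stars_below_def stars_def)

text \<open>At most \<open>U\<close> summands, each a digit below \<open>K\<close> times at most
  \<open>l\<close> stars; \<open>U\<close>, \<open>K\<close> and \<open>l\<close> are all bounded by
  \<open>H\<close>.\<close>

lemma stars_below_le: "j \<le> U \<Longrightarrow> stars_below z j \<le> H * (H * H)"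
proof -
  assume j: "j \<le> U"
  have "stars_below z j \<le> (\<Sum>v<j. H * H)"
    unfolding stars_below_def
  proof (intro sum_mono mult_mono)
    fix v assume "v \<in> {..<j}"
    with j have "v < U" by simp
    then show "W v \<le> H" using W_le[of v] H by simp
    show "digit K z v \<le> H" using digit_less[of K z v] K H by simp
  qed auto
  also have "\<dots> \<le> H * (H * H)" using j H by (simp add: mult_right_mono)
  finally show ?thesis .
qed

lemma rows_with_le: "rows_with u \<le> H"
  using rows_before_le[of n u] H by (simp add: rows_before_n)

lemma config_le: "config z v \<le> H"
  using rows_with_le[of v] digit_less[of K z v] K H by (auto simp: config_def)

lemma wp_Div_loop:
  assumes "regs s ''y'' = y" "regs s ''q'' = 0" "regs s ''K'' = K" "Suc y < 2 ^ w"
  shows "wp w Div_loop (\<lambda>t s'. regs s' ''q'' = y div K \<and> regs s' ''y'' = y mod K \<and> t \<le> 6 + 14 * y) 0 s"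
proof (rule wp_While[where I = "\<lambda>t s'. regs s' ''y'' + K * regs s' ''q'' = y \<and> t = 14 * regs s' ''q''"
      and \<mu> = "\<lambda>s'. regs s' ''y''"])
  fix t s'
  let ?p = "Seq (Assign ''y'' (Sub (Reg ''y'') (Reg ''K''))) (Assign ''q'' (Add (Reg ''q'') (Const 1)))"
  assume I: "regs s' ''y'' + K * regs s' ''q'' = y \<and> t = 14 * regs s' ''q''"
    and f: "same (mod_regs ?p) (mod_mem ?p) s s'"
  have k: "regs s' ''K'' = K" using sameR[OF f] assms by simp
  have q: "K * regs s' ''q'' \<le> y" using I by linarith
  have q': "regs s' ''q'' \<le> y" using order.trans[OF mult_right_mono[of 1 K "regs s' ''q''"] q] K by simp
  show "safe w s' (Sub (Add (Reg ''y'') (Const 1)) (Reg ''K''))"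
    using I assms(4) by simp
  {
    assume "val s' (Sub (Add (Reg ''y'') (Const 1)) (Reg ''K'')) \<noteq> 0"
    then have "K \<le> regs s' ''y''" using k by simp
    then show "wp w ?p (\<lambda>t s''. (regs s'' ''y'' + K * regs s'' ''q'' = y \<and> t = 14 * regs s'' ''q'') \<and>
        regs s'' ''y'' < regs s' ''y'') (t + (1 + ops (Sub (Add (Reg ''y'') (Const 1)) (Reg ''K'')))) s'"
      using I k K q' assms(4) by (simp add: algebra_simps)
  }
  {
    assume "val s' (Sub (Add (Reg ''y'') (Const 1)) (Reg ''K'')) = 0"
    then have "regs s' ''y'' < K" using k by simp
    moreover from this have "y div K = regs s' ''q''" "y mod K = regs s' ''y''"
      using I by (auto simp: add.commute[of "regs s' ''y''"])
    ultimately show "regs s' ''q'' = y div K \<and> regs s' ''y'' = y mod K \<and>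
        t + (1 + ops (Sub (Add (Reg ''y'') (Const 1)) (Reg ''K''))) \<le> 6 + 14 * y"
      using I q' by simp
  }
qed (use assms in simp)

lemma wp_Cost_loop:
  assumes "regs s ''y'' = d" "regs s ''s'' = m" "mem s ''W'' (regs s ''u'') = v" "m + d * v < 2 ^ w"
  shows "wp w Cost_loop (\<lambda>t s'. regs s' ''s'' = m + d * v \<and> t = 6 + 13 * d) 0 s"
proof (rule wp_For[where N = d and I = "\<lambda>i t s'. regs s' ''s'' = m + i * v \<and> t = 13 * i"])
  fix i t s'
  let ?p = "Assign ''s'' (Add (Reg ''s'') (Load ''W'' (Reg ''u'')))"
  assume i: "i < d" and I: "regs s' ''s'' = m + i * v \<and> t = 13 * i"
    and f: "same (insert ''j'' (mod_regs ?p)) (mod_mem ?p) s s'"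
  have v: "mem s' ''W'' (regs s' ''u'') = v" using sameR[OF f] sameM[OF f] assms by simp
  have "Suc i * v \<le> d * v" using i by (intro mult_right_mono) auto
  with assms(4) have "m + i * v + v < 2 ^ w" by simp
  then show "wp w ?p (\<lambda>t s''. regs (setr ''j'' (Suc i) s'') ''s'' = m + Suc i * v \<and> t + 8 = 13 * Suc i) t s'"
    using I v by simp
qed (use assms in auto)

definition "Z = K ^ U"

lemma UZ: "U \<le> Z" "K \<le> Z" "Z \<le> H"
  using U_le_configs K_le_configs H by (simp_all add: Z_def)

lemma wp_Decode:
  assumes "loaded s" "z < Z" "regs s ''y'' = z" "regs s ''o'' = 1" "regs s ''s'' = 0"
  shows "wp w Decode (\<lambda>t s'. (\<forall>v<U. mem s' ''X'' v = config z v) \<and> regs s' ''s'' = stars z \<and>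
    regs s' ''o'' = of_bool (sums_ok z) \<and> t \<le> 6 + U * (60 + 27 * Z)) 0 s"
  unfolding Decode_def
proof (rule wp_For[where N = U and I = "\<lambda>j t s'. (\<forall>v<j. mem s' ''X'' v = partial z j v) \<and>
    regs s' ''s'' = stars_below z j \<and> regs s' ''y'' = z div K ^ j \<and>
    regs s' ''o'' = of_bool (\<forall>r<U. starred z r j \<le> rows_with r) \<and> t \<le> j * (60 + 27 * Z)"])
  fix j t s'
  assume j: "j < U" and I: "(\<forall>v<j. mem s' ''X'' v = partial z j v) \<and>
    regs s' ''s'' = stars_below z j \<and> regs s' ''y'' = z div K ^ j \<and>
    regs s' ''o'' = of_bool (\<forall>r<U. starred z r j \<le> rows_with r) \<and> t \<le> j * (60 + 27 * Z)"
    and u: "regs s' ''u'' = j"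
    and f: "same (insert ''u'' (mod_regs Decode_body)) (mod_mem Decode_body) s s'"
  have ld: "loaded s'" using loaded_same[OF assms(1) f] by simp
  let ?d = "digit K z j"
  have y: "z div K ^ j div K = z div K ^ Suc j" "z div K ^ j mod K = ?d"
    by (simp_all add: digit_def div_mult2_eq mult.commute[of K])
  have yz: "z div K ^ j \<le> z" by (rule div_le_dividend)
  have yZ: "z div K ^ j \<le> Z" using yz assms(2) by linarith
  have zH: "z < H" using assms(2) UZ by simp
  have reads: "mem s' ''R'' j = R j" "mem s' ''W'' j = W j" "mem s' ''N'' j = rows_with j" "regs s' ''K'' = K"
    using ld j by (auto simp: loaded_def tables_def params_def)
  have s_le: "stars_below z j + ?d * W j < 2 ^ w"
    using stars_below_le[of "Suc j" z] j fitsHHH by (simp add: stars_below_Suc)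
  have dK: "?d < K" using K by (simp add: digit_less)
  have "R j \<le> j" by (rule R_le)
  have X: "partial z (Suc j) v = (if v = R j \<and> R j \<noteq> j then partial z j v - ?d else partial z j v)" if "v < j" for v
    using that R_idem[OF j] by (auto simp: partial_def starred_Suc)
  have Xj: "partial z (Suc j) j = (if R j = j then rows_with j else ?d)"
    by (auto simp: partial_def starred_Suc starred_eq_0)
  have PR: "partial z j (R j) = rows_with (R j) - starred z (R j) j"
    using R_idem[OF j] by (simp add: partial_def)
  \<comment> \<open>The program compares the digit with a truncated remainder. As long as no sum has
    exceeded its bound, the remainder is exact; once one has, the flag is cleared for good.\<close>
  have ok: "(\<forall>r<U. starred z r (Suc j) \<le> rows_with r) \<longleftrightarrow> (\<forall>r<U. starred z r j \<le> rows_with r) \<and>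
      (R j = j \<or> ?d \<le> partial z j (R j))"
  proof -
    have "R j < U" using R_less j by simp
    show ?thesis
    proof (cases "R j = j")
      case True
      then show ?thesis by (auto simp: starred_Suc)
    next
      case False
      have eq: "starred z r (Suc j) = (if r = R j then starred z r j + ?d else starred z r j)" for r
        using False by (auto simp: starred_Suc)
      show ?thesis
        unfolding PR eq
      proof (intro iffI conjI allI impI)
        assume *: "\<forall>r<U. (if r = R j then starred z r j + ?d else starred z r j) \<le> rows_with r"
        show "starred z r j \<le> rows_with r" if "r < U" for r
          using *[rule_format, OF that] by (simp split: if_splits)
        show "R j = j \<or> ?d \<le> rows_with (R j) - starred z (R j) j"
          using *[rule_format, OF \<open>R j < U\<close>] by (simp only: if_True simp_thms) linarith
      next
        fix r assume *: "(\<forall>r<U. starred z r j \<le> rows_with r) \<and>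
          (R j = j \<or> ?d \<le> rows_with (R j) - starred z (R j) j)" "r < U"
        then have "starred z r j \<le> rows_with r" "?d \<le> rows_with (R j) - starred z (R j) j"
          using False by blast+
        then show "(if r = R j then starred z r j + ?d else starred z r j) \<le> rows_with r" by auto
      qed
    qed
  qed
  define ob ob' :: nat where "ob = of_bool (\<forall>r<U. starred z r j \<le> rows_with r)"
    and "ob' = of_bool (\<forall>r<U. starred z r (Suc j) \<le> rows_with r)"
  have ok': "ob' = (if R j = j \<or> ?d \<le> partial z j (R j) then ob else 0)"
    unfolding ob_def ob'_def ok by simp
  let ?I = "\<lambda>t s0. (\<forall>v<Suc j. mem (setr ''u'' (Suc j) s0) ''X'' v = partial z (Suc j) v) \<and>
      regs (setr ''u'' (Suc j) s0) ''s'' = stars_below z (Suc j) \<and>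
      regs (setr ''u'' (Suc j) s0) ''y'' = z div K ^ Suc j \<and>
      regs (setr ''u'' (Suc j) s0) ''o'' = ob' \<and>
      t + 8 \<le> Suc j * (60 + 27 * Z)"
  have rest: "wp w (Assign ''r'' (Load ''R'' (Reg ''u'')) ;;
    Cond (Add (Sub (Reg ''r'') (Reg ''u'')) (Sub (Reg ''u'') (Reg ''r'')))
      (Store ''X'' (Reg ''u'') (Reg ''y'') ;;
       Cond (Sub (Reg ''y'') (Load ''X'' (Reg ''r''))) (Assign ''o'' (Const 0)) Skip ;;
       Store ''X'' (Reg ''r'') (Sub (Load ''X'' (Reg ''r'')) (Reg ''y'')) ;;
       Cost_loop)
      (Store ''X'' (Reg ''u'') (Load ''N'' (Reg ''u''))) ;;
    Assign ''y'' (Reg ''q'')) ?I t0 s0"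
    if s0: "regs s0 ''u'' = j" "regs s0 ''y'' = ?d" "regs s0 ''q'' = z div K ^ Suc j"
      "regs s0 ''s'' = stars_below z j" "regs s0 ''o'' = ob"
      "mem s0 = mem s'" "t0 \<le> t + (8 + 14 * Z)" for t0 s0
  proof (cases "R j = j")
    case True
    \<comment> \<open>A star-free copy has weight 0, so skipping the cost loop loses
      nothing.\<close>
    have "?d * W j = 0" using True R_eq_self_iff[OF j] by simp
    note facts = s0(1-6) reads True ok' stars_below_Suc this
    show ?thesis
      by (simp add: facts; insert s0(7) I X Xj True; auto simp: less_Suc_eq)
  next
    case False
    with \<open>R j \<le> j\<close> have Rj: "R j < j" "R j - j + (j - R j) < 2 ^ w" "R j \<noteq> j" "j \<noteq> R j" "R j \<le> j" "\<not> j \<le> R j" "j - R j < 2 ^ w"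
      using j H by (auto intro!: fits1)
    have p: "mem s' ''X'' (R j) = partial z j (R j)" using I Rj by blast
    note cost = wp_conseq[OF wp_Cost_loop[where d = ?d and m = "stars_below z j" and v = "W j"]]
    note facts = s0(1-6) reads p Rj
    show ?thesis
      apply (simp add: facts)
      apply (intro conjI impI; rule cost)
      apply (simp_all add: facts s_le same_def)
      using s0(7) I dK UZ X Xj Rj
      by (auto simp: less_Suc_eq stars_below_Suc ok' algebra_simps)
  qed
  have "wp w Decode_body ?I t s'"
    apply simp
    apply (rule wp_conseq[OF wp_Div_loop[where y = "z div K ^ j"]])
    subgoal using I by simp
    subgoal by simp
    subgoal by (simp add: reads)
    subgoal using le_less_trans[OF yz zH] by (intro fits1) simp
    subgoal for t' s0
      by (rule rest) (use I u yZ in \<open>simp_all add: same_def y ob_def fun_eq_iff\<close>)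
    done
  then show "wp w Decode_body (\<lambda>t s0. (\<forall>v<Suc j. mem (setr ''u'' (Suc j) s0) ''X'' v = partial z (Suc j) v) \<and>
      regs (setr ''u'' (Suc j) s0) ''s'' = stars_below z (Suc j) \<and>
      regs (setr ''u'' (Suc j) s0) ''y'' = z div K ^ Suc j \<and>
      regs (setr ''u'' (Suc j) s0) ''o'' = of_bool (\<forall>r<U. starred z r (Suc j) \<le> rows_with r) \<and>
      t + 8 \<le> Suc j * (60 + 27 * Z)) t s'"
    unfolding ob'_def .
qed (use assms starred_eq_0 in \<open>auto simp: stars_below_0 stars_below_U partial_U sums_ok_def loaded_def tables_def params_def\<close>)

end

section \<open>Search for a cheapest feasible choice\<close>

text \<open>\<open>e\<close> is one more than the least cost found so far, and \<open>0\<close> as long as there is none.\<close>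

abbreviation Search_body :: com where
  "Search_body \<equiv> Evaluate ;; Cond (Reg ''o'')
    (Cond (Add (Sub (Const 1) (Reg ''e'')) (Sub (Reg ''e'') (Add (Reg ''s'') (Const 1))))
      (Assign ''e'' (Add (Reg ''s'') (Const 1)) ;; Assign ''g'' (Reg ''z'')) Skip) Skip"

definition Search :: com where
  "Search = Assign ''e'' (Const 0) ;; Assign ''g'' (Const 0) ;; For ''z'' ''Z'' Search_body"

lemma mod_Search [simp]:
  "mod_regs Search = {''e'', ''g'', ''z'', ''u'', ''q'', ''y'', ''r'', ''o'', ''j'', ''s''}"
  "mod_mem Search = {''X'', ''F''}"
  by (auto simp: Search_def)

context ram
begin

lemma wp_Clear:
  assumes "params s"
  shows "wp w Clear (\<lambda>t s'. (\<forall>v<U. mem s' ''F'' v = 0) \<and> t \<le> 6 + 11 * U) 0 s"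
  unfolding Clear_def
  by (rule wp_For[where N = U and I = "\<lambda>j t s'. (\<forall>v<j. mem s' ''F'' v = 0) \<and> t = 11 * j"])
    (use assms in \<open>auto simp: params_def less_Suc_eq\<close>)

definition "size_below z j p = (\<Sum>v\<in>{v \<in> {..<j}. P v = p}. config z v)"

lemma size_below_Suc: "size_below z (Suc j) p = size_below z j p + (if P j = p then config z j else 0)"
proof -
  have "{v \<in> {..<Suc j}. P v = p} =
      (if P j = p then insert j {v \<in> {..<j}. P v = p} else {v \<in> {..<j}. P v = p})"
    by (auto simp: less_Suc_eq)
  then show ?thesis by (simp add: size_below_def)
qed

lemma size_below_0: "size_below z 0 p = 0" and size_below_U: "size_below z U p = group_size z p"
  by (simp_all add: size_below_def group_size_def)

lemma size_below_le: "j \<le> U \<Longrightarrow> size_below z j p \<le> H * H"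
proof -
  assume j: "j \<le> U"
  have "size_below z j p \<le> (\<Sum>v\<in>{v \<in> {..<j}. P v = p}. H)"
    unfolding size_below_def by (intro sum_mono config_le)
  also have "\<dots> = card {v \<in> {..<j}. P v = p} * H" by simp
  also have "\<dots> \<le> card {..<j} * H" by (intro mult_right_mono card_mono) auto
  also have "\<dots> \<le> H * H" using j H by (intro mult_right_mono) auto
  finally show ?thesis .
qed

lemma wp_Sizes:
  assumes "loaded s" "\<forall>v<U. mem s ''X'' v = config z v" "\<forall>v<U. mem s ''F'' v = 0"
  shows "wp w Sizes (\<lambda>t s'. (\<forall>v<U. mem s' ''F'' v = group_size z v) \<and> t \<le> 6 + 17 * U) 0 s"
  unfolding Sizes_def
proof (rule wp_For[where N = U and I = "\<lambda>j t s'. (\<forall>v<U. mem s' ''F'' v = size_below z j v) \<and> t = 17 * j"])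
  fix j t s'
  assume j: "j < U" and I: "(\<forall>v<U. mem s' ''F'' v = size_below z j v) \<and> t = 17 * j"
    and u: "regs s' ''u'' = j"
    and f: "same (insert ''u'' (mod_regs Sizes_body)) (mod_mem Sizes_body) s s'"
  have Pj: "P j < U" using j P_less by simp
  have "loaded s'" using loaded_same[OF assms(1) f] by simp
  then have r: "mem s' ''P'' j = P j" using j by (simp add: loaded_def tables_def)
  have x: "mem s' ''X'' j = config z j" using sameM[OF f] assms(2) j by simp
  have F: "mem s' ''F'' (P j) = size_below z j (P j)" using I Pj by blast
  have "size_below z j (P j) + config z j = size_below z (Suc j) (P j)" by (simp add: size_below_Suc)
  also have "\<dots> < 2 ^ w" using j by (intro fitsHH size_below_le) simp
  finally have safe: "size_below z j (P j) + config z j < 2 ^ w" .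
  show "wp w Sizes_body (\<lambda>t s''. (\<forall>v<U. mem (setr ''u'' (Suc j) s'') ''F'' v = size_below z (Suc j) v) \<and>
      t + 8 = 17 * Suc j) t s'"
    by (simp add: u r x F safe) (use I in \<open>auto simp: size_below_Suc\<close>)
qed (use assms in \<open>auto simp: size_below_0 size_below_U loaded_def tables_def params_def\<close>)

lemma wp_Check:
  assumes "loaded s" "\<forall>v<U. mem s ''F'' v = group_size z v" "regs s ''o'' = ob"
  shows "wp w Check (\<lambda>t s'. regs s' ''o'' = (if \<forall>p<U. group_size z p = 0 \<or> k \<le> group_size z p then ob else 0) \<and>
    t \<le> 6 + 18 * U) 0 s"
  unfolding Check_def
proof (rule wp_For[where N = U and I = "\<lambda>j t s'. regs s' ''o'' =
    (if \<forall>p<j. group_size z p = 0 \<or> k \<le> group_size z p then ob else 0) \<and> t \<le> 18 * j"])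
  fix j t s'
  assume j: "j < U" and I: "regs s' ''o'' =
      (if \<forall>p<j. group_size z p = 0 \<or> k \<le> group_size z p then ob else 0) \<and> t \<le> 18 * j"
    and u: "regs s' ''u'' = j"
    and f: "same (insert ''u'' (mod_regs Check_body)) (mod_mem Check_body) s s'"
  have "loaded s'" using loaded_same[OF assms(1) f] by simp
  then have r: "regs s' ''k'' = k" by (simp add: loaded_def tables_def params_def)
  have F: "mem s' ''F'' j = group_size z j" using sameM[OF f] assms(2) j by simp
  show "wp w Check_body (\<lambda>t s''. regs (setr ''u'' (Suc j) s'') ''o'' =
      (if \<forall>p<Suc j. group_size z p = 0 \<or> k \<le> group_size z p then ob else 0) \<and> t + 8 \<le> 18 * Suc j) t s'"
    by (simp add: u r F) (use I in \<open>auto simp: less_Suc_eq\<close>)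
qed (use assms in \<open>auto simp: loaded_def tables_def params_def\<close>)

lemma wp_Evaluate:
  assumes ld: "loaded s" and z: "z < Z" "regs s ''z'' = z"
  shows "wp w Evaluate (\<lambda>t s'. (\<forall>v<U. mem s' ''X'' v = config z v) \<and> regs s' ''s'' = stars z \<and>
    regs s' ''o'' = of_bool (feasible z) \<and> t \<le> 30 + U * (106 + 27 * Z)) 0 s"
proof -
  note [simp] = z
  have p: "loaded s' \<Longrightarrow> params s'" for s' by (simp add: loaded_def tables_def)
  let ?Q = "\<lambda>t s'. (\<forall>v<U. mem s' ''X'' v = config z v) \<and> regs s' ''s'' = stars z \<and>
    regs s' ''o'' = of_bool (feasible z) \<and> t \<le> 30 + U * (106 + 27 * Z)"
  have 4: "wp w Check ?Q t s'"
    if "loaded s'" "\<forall>v<U. mem s' ''X'' v = config z v" "regs s' ''s'' = stars z"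
      "regs s' ''o'' = of_bool (sums_ok z)" "\<forall>v<U. mem s' ''F'' v = group_size z v"
      "t \<le> 24 + U * (88 + 27 * Z)" for t s'
    by (rule wp_conseq[OF wp_Check[OF that(1,5,4)]])
      (use that in \<open>auto simp: same_def feasible_def algebra_simps\<close>)
  have 3: "wp w Sizes (wp w Check ?Q) t s'"
    if "loaded s'" "\<forall>v<U. mem s' ''X'' v = config z v" "regs s' ''s'' = stars z"
      "regs s' ''o'' = of_bool (sums_ok z)" "\<forall>v<U. mem s' ''F'' v = 0"
      "t \<le> 18 + U * (71 + 27 * Z)" for t s'
  proof (rule wp_conseq[OF wp_Sizes[OF that(1,2,5)]], rule 4)
    fix t' s'' assume f: "same (mod_regs Sizes) (mod_mem Sizes) s' s''"
    show "loaded s''" using loaded_same[OF that(1) f] by simp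
  qed (use that in \<open>auto simp: same_def algebra_simps\<close>)
  have 2: "wp w Clear (wp w Sizes (wp w Check ?Q)) t s'"
    if "loaded s'" "\<forall>v<U. mem s' ''X'' v = config z v" "regs s' ''s'' = stars z"
      "regs s' ''o'' = of_bool (sums_ok z)" "t \<le> 12 + U * (60 + 27 * Z)" for t s'
  proof (rule wp_conseq[OF wp_Clear[OF p[OF that(1)]]], rule 3)
    fix t' s'' assume f: "same (mod_regs Clear) (mod_mem Clear) s' s''"
    show "loaded s''" using loaded_same[OF that(1) f] by simp
  qed (use that in \<open>auto simp: same_def algebra_simps\<close>)
  have 1: "wp w Decode (wp w Clear (wp w Sizes (wp w Check ?Q))) t s'"
    if "loaded s'" "regs s' ''y'' = z" "regs s' ''o'' = 1" "regs s' ''s'' = 0" "t \<le> 6" for t s'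
  proof (rule wp_conseq[OF wp_Decode[OF that(1) z(1) that(2-4)]], rule 2)
    fix t' s'' assume f: "same (mod_regs Decode) (mod_mem Decode) s' s''"
    show "loaded s''" using loaded_same[OF that(1) f] by simp
  qed (use that in \<open>auto simp: same_def algebra_simps\<close>)
  show ?thesis
    unfolding Evaluate_def wp.simps(4) by (simp split del: split_of_bool, rule 1) (use ld in simp_all)
qed

definition "best j e g \<longleftrightarrow> (if e = 0 then \<forall>z<j. \<not> feasible z
  else g < j \<and> feasible g \<and> e = Suc (stars g) \<and> (\<forall>z<j. feasible z \<longrightarrow> stars g \<le> stars z))"

lemma best_Suc:
  assumes "best j e g"
  shows "\<not> feasible j \<Longrightarrow> best (Suc j) e g"
    "feasible j \<Longrightarrow> e = 0 \<or> Suc (stars j) < e \<Longrightarrow> best (Suc j) (Suc (stars j)) j"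
    "feasible j \<Longrightarrow> \<not> (e = 0 \<or> Suc (stars j) < e) \<Longrightarrow> best (Suc j) e g"
  using assms by (auto simp: best_def less_Suc_eq split: if_splits)

lemma stars_le: "stars z \<le> H * (H * H)"
  using stars_below_le[of U z] by (simp add: stars_below_U)

lemma wp_Search:
  assumes ld: "loaded s" and Z: "regs s ''Z'' = Z"
  shows "wp w Search (\<lambda>t s'. best Z (regs s' ''e'') (regs s' ''g'') \<and>
    t \<le> 10 + Z * (60 + U * (106 + 27 * Z))) 0 s"
proof -
  have main: "wp w (For ''z'' ''Z'' Search_body) (\<lambda>t s''. best Z (regs s'' ''e'') (regs s'' ''g'') \<and>
      t \<le> 6 + Z * (60 + U * (106 + 27 * Z))) 0 s'"
    if "loaded s'" "regs s' ''Z'' = Z" "regs s' ''e'' = 0" for s'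
  proof (rule wp_For[where N = Z and I = "\<lambda>j t s''. best j (regs s'' ''e'') (regs s'' ''g'') \<and>
      t \<le> j * (60 + U * (106 + 27 * Z))"])
    fix j t s''
    assume j: "j < Z" and I: "best j (regs s'' ''e'') (regs s'' ''g'') \<and> t \<le> j * (60 + U * (106 + 27 * Z))"
      and z: "regs s'' ''z'' = j"
      and f: "same (insert ''z'' (mod_regs Search_body)) (mod_mem Search_body) s' s''"
    have ld: "loaded s''" using loaded_same[OF that(1) f] by simp
    let ?e = "regs s'' ''e''" and ?g = "regs s'' ''g''"
    have e: "?e \<le> Suc (H * (H * H))" using I stars_le[of ?g] by (auto simp: best_def split: if_splits)
    have b: "best j ?e ?g" using I by simp
    \<comment> \<open>\<open>stars j\<close> is bounded only by the third power of \<open>H\<close>,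
      which its successor may exceed; hence the fourth power as the common bound.\<close>
    have HHHH: "H * (H * H) + H * (H * H) \<le> H * (H * (H * H))"
      using mult_right_mono[OF H(8), of "H * (H * H)"] by linarith
    moreover have "2 \<le> H * (H * H)" using HH H(8) by linarith
    ultimately have safe: "Suc (stars j) < 2 ^ w" "1 - ?e + (?e - Suc (stars j)) < 2 ^ w" "?e - Suc (stars j) < 2 ^ w"
      using stars_le[of j] e by (intro fits4; linarith)+
    show "wp w Search_body (\<lambda>t s0. best (Suc j) (regs (setr ''z'' (Suc j) s0) ''e'') (regs (setr ''z'' (Suc j) s0) ''g'') \<and>
        t + 8 \<le> Suc j * (60 + U * (106 + 27 * Z))) t s''"
    proof (simp, rule wp_conseq[OF wp_Evaluate[OF ld j z]])
      fix t' s0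
      assume ev: "(\<forall>v<U. mem s0 ''X'' v = config j v) \<and> regs s0 ''s'' = stars j \<and>
        regs s0 ''o'' = of_bool (feasible j) \<and> t' \<le> 30 + U * (106 + 27 * Z)"
        and f0: "same (mod_regs Evaluate) (mod_mem Evaluate) s'' s0"
      have r: "regs s0 ''e'' = ?e" "regs s0 ''g'' = ?g" "regs s0 ''z'' = j" "regs s0 ''s'' = stars j"
        using sameR[OF f0] z ev by simp_all
      show "wp w (Cond (Reg ''o'')
        (Cond (Add (Sub (Const 1) (Reg ''e'')) (Sub (Reg ''e'') (Add (Reg ''s'') (Const 1))))
          (Assign ''e'' (Add (Reg ''s'') (Const 1)) ;; Assign ''g'' (Reg ''z'')) Skip) Skip)
        (\<lambda>t s0. best (Suc j) (regs (setr ''z'' (Suc j) s0) ''e'') (regs (setr ''z'' (Suc j) s0) ''g'') \<and>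
        t + 8 \<le> Suc j * (60 + U * (106 + 27 * Z))) (t + t') s0"
      proof (cases "feasible j")
        case False
        then have "regs s0 ''o'' = 0" using ev by simp
        then show ?thesis using I ev best_Suc(1)[OF b False] by (simp add: r)
      next
        case True
        then have o: "regs s0 ''o'' = 1" using ev by simp
        show ?thesis
        proof (cases "?e = 0 \<or> Suc (stars j) < ?e")
          case T: True
          have t: "t + t' + 30 \<le> Suc j * (60 + U * (106 + 27 * Z))" using I ev by simp
          show ?thesis
            by (simp add: r o safe; insert T t safe(3) best_Suc(2)[OF b True T]; auto)
        next
          case F: False
          have t: "t + t' + 30 \<le> Suc j * (60 + U * (106 + 27 * Z))" using I ev by simp
          show ?thesis
            by (simp add: r o safe; insert F t safe(3) best_Suc(3)[OF b True F]; auto)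
        qed
      qed
    qed
  qed (use that in \<open>auto simp: best_def\<close>)
  show ?thesis
    unfolding Search_def by (simp; rule wp_conseq[OF main]; use ld Z in simp)
qed

end

section \<open>Distributing the copies over the rows\<close>

text \<open>\<open>H[r]\<close> only moves upwards over copies of the row \<open>r\<close> that are used up, hence at most \<open>U\<close> times for
  each \<open>r\<close> in total. The loop stops when \<open>R[H[r]] = r\<close> and \<open>X[H[r]] > 0\<close>.\<close>

abbreviation Find_loop :: com where
  "Find_loop \<equiv> While
    (Add (Add (Sub (Load ''R'' (Load ''H'' (Reg ''r''))) (Reg ''r''))
              (Sub (Reg ''r'') (Load ''R'' (Load ''H'' (Reg ''r'')))))
         (Sub (Const 1) (Load ''X'' (Load ''H'' (Reg ''r'')))))
    (Store ''H'' (Reg ''r'') (Add (Load ''H'' (Reg ''r'')) (Const 1)))"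

text \<open>Repeated division yields the last column first, so \<open>a\<close> starts at the end of
  the row and moves backwards.\<close>

abbreviation Write_row :: com where
  "Write_row \<equiv> Assign ''a'' (Sub (Reg ''a'') (Const 1)) ;;
    Store ''E'' (Reg ''a'') (Load ''G'' (Reg ''v'')) ;;
    Assign ''v'' (Load ''Q'' (Reg ''v''))"

abbreviation Output_body :: com where
  "Output_body \<equiv> Assign ''r'' (Load ''C'' (Reg ''i'')) ;; Find_loop ;;
    Assign ''v'' (Load ''H'' (Reg ''r'')) ;;
    Store ''X'' (Reg ''v'') (Sub (Load ''X'' (Reg ''v'')) (Const 1)) ;;
    Assign ''a'' (Add (Reg ''a'') (Reg ''l'')) ;;
    For ''j'' ''l'' Write_row ;;
    Assign ''a'' (Add (Reg ''a'') (Reg ''l''))"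

definition Output :: com where
  "Output = Assign ''a'' (Const 0) ;; For ''i'' ''n'' Output_body"

lemma mod_Output [simp]: "mod_regs Output = {''a'', ''i'', ''r'', ''v'', ''j''}"
  "mod_mem Output = {''H'', ''X'', ''E''}"
  by (auto simp: Output_def)

context ram
begin

lemma wp_Find_loop:
  assumes tab: "tables s" and r: "regs s ''r'' = r" and h: "mem s ''H'' r \<le> u" and u: "u < U" "R u = r" "0 < mem s ''X'' u"
  shows "wp w Find_loop (\<lambda>t s'. \<exists>h. mem s ''H'' r \<le> h \<and> h \<le> u \<and> R h = r \<and> 0 < mem s ''X'' h \<and>
    (\<forall>v. mem s ''H'' r \<le> v \<longrightarrow> v < h \<longrightarrow> R v = r \<longrightarrow> mem s ''X'' v = 0) \<and>
    mem s' ''H'' = (mem s ''H'')(r := h) \<and> t = 18 + 24 * (h - mem s ''H'' r)) 0 s"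
proof (rule wp_While[where \<mu> = "\<lambda>s'. U - mem s' ''H'' r" and I = "\<lambda>t s'. \<exists>h. mem s ''H'' r \<le> h \<and> h \<le> u \<and>
    (\<forall>v. mem s ''H'' r \<le> v \<longrightarrow> v < h \<longrightarrow> R v = r \<longrightarrow> mem s ''X'' v = 0) \<and>
    mem s' ''H'' = (mem s ''H'')(r := h) \<and> t = 24 * (h - mem s ''H'' r)"])
  let ?H = "mem s ''H''"
  let ?I = "\<lambda>t s'. \<exists>h. ?H r \<le> h \<and> h \<le> u \<and>
    (\<forall>v. ?H r \<le> v \<longrightarrow> v < h \<longrightarrow> R v = r \<longrightarrow> mem s ''X'' v = 0) \<and>
    mem s' ''H'' = ?H(r := h) \<and> t = 24 * (h - ?H r)"
  let ?p = "Store ''H'' (Reg ''r'') (Add (Load ''H'' (Reg ''r'')) (Const 1))"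
  let ?e = "Add (Add (Sub (Load ''R'' (Load ''H'' (Reg ''r''))) (Reg ''r''))
              (Sub (Reg ''r'') (Load ''R'' (Load ''H'' (Reg ''r'')))))
         (Sub (Const 1) (Load ''X'' (Load ''H'' (Reg ''r''))))"
  show "?I 0 s" using h by (intro exI[of _ "?H r"]) simp
  fix t s' assume "?I t s'" and f: "same (mod_regs ?p) (mod_mem ?p) s s'"
  then obtain h where I: "?H r \<le> h" "h \<le> u" "\<And>v. ?H r \<le> v \<Longrightarrow> v < h \<Longrightarrow> R v = r \<Longrightarrow> mem s ''X'' v = 0"
    "mem s' ''H'' = ?H(r := h)" "t = 24 * (h - ?H r)" by blast
  have hU: "h < U" using I u by simp
  then have reads: "mem s' ''R'' h = R h" "mem s' ''X'' = mem s ''X''" "regs s' ''r'' = r" "mem s' ''H'' r = h"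
    using tab r sameR[OF f] sameM[OF f] I(4) by (simp_all add: tables_def)
  have rU: "r < U" "R h < U" using u R_less hU by auto
  have le: "R h - r + (r - R h) \<le> H" "R h - r + (r - R h) + (Suc 0 - mem s ''X'' h) \<le> 2 * H"
    using rU H by linarith+
  show "safe w s' ?e"
    using fits1[OF le(1)] fits2[OF le(2)] by (simp add: reads)
  have v: "val s' ?e = R h - r + (r - R h) + (Suc 0 - mem s ''X'' h)"
    by (simp add: reads)
  {
    assume "val s' ?e \<noteq> 0"
    then have ne: "R h \<noteq> r \<or> mem s ''X'' h = 0" unfolding v by auto
    with u have "h \<noteq> u" by auto
    with I have "h < u" by simp
    then have "Suc h < 2 ^ w" using u H by (intro fits1) simp
    moreover have "?I (t + 24) (setm ''H'' r (Suc h) s')"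
      using I ne \<open>h < u\<close> by (intro exI[of _ "Suc h"]) (auto simp: less_Suc_eq)
    ultimately show "wp w ?p (\<lambda>t s''. ?I t s'' \<and> U - mem s'' ''H'' r < U - mem s' ''H'' r) (t + (1 + ops ?e)) s'"
      using hU by (simp add: reads add.commute[of _ t] numeral_eq_Suc)
  }
  {
    assume "val s' ?e = 0"
    then have "R h = r" "0 < mem s ''X'' h" unfolding v by auto
    with I show "\<exists>h. ?H r \<le> h \<and> h \<le> u \<and> R h = r \<and> 0 < mem s ''X'' h \<and>
        (\<forall>v. ?H r \<le> v \<longrightarrow> v < h \<longrightarrow> R v = r \<longrightarrow> mem s ''X'' v = 0) \<and>
        mem s' ''H'' = ?H(r := h) \<and> t + (1 + ops ?e) = 18 + 24 * (h - ?H r)"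
      by (intro exI[of _ h]) auto
  }
qed

lemma wp_Write_row:
  assumes "tables s" "regs s ''v'' = u" "u < U" "regs s ''a'' = m + l"
  shows "wp w (For ''j'' ''l'' Write_row)
    (\<lambda>t s'. (\<forall>j<l. mem s' ''E'' (m + j) = min c (digit b u (l - Suc j))) \<and>
      (\<forall>x<m. mem s' ''E'' x = mem s ''E'' x) \<and> regs s' ''a'' = m \<and> t = 6 + 19 * l) 0 s"
proof (rule wp_For[where N = l and I = "\<lambda>j t s'. regs s' ''a'' = m + (l - j) \<and> regs s' ''v'' = u div b ^ j \<and>
    (\<forall>i<l. l - j \<le> i \<longrightarrow> mem s' ''E'' (m + i) = min c (digit b u (l - Suc i))) \<and>
    (\<forall>x<m. mem s' ''E'' x = mem s ''E'' x) \<and> t = 19 * j"])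
  fix j t s'
  assume j: "j < l" and I: "regs s' ''a'' = m + (l - j) \<and> regs s' ''v'' = u div b ^ j \<and>
    (\<forall>i<l. l - j \<le> i \<longrightarrow> mem s' ''E'' (m + i) = min c (digit b u (l - Suc i))) \<and>
    (\<forall>x<m. mem s' ''E'' x = mem s ''E'' x) \<and> t = 19 * j"
    and f: "same (insert ''j'' (mod_regs Write_row)) (mod_mem Write_row) s s'"
  have "u div b ^ j < U" using assms(3) by (rule le_less_trans[OF div_le_dividend])
  moreover have "tables s'" using tables_same[OF assms(1) f] by simp
  ultimately have reads: "mem s' ''G'' (u div b ^ j) = min c (digit b u j)" "mem s' ''Q'' (u div b ^ j) = u div (b * b ^ j)"
    by (simp_all add: tables_def digit_def div_mult2_eq mult.commute[of b])
  have a: "m + (l - j) - Suc 0 = m + (l - Suc j)" "m + (l - j) - 1 = m + (l - Suc j)" using j by auto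
  show "wp w Write_row (\<lambda>t s''. regs (setr ''j'' (Suc j) s'') ''a'' = m + (l - Suc j) \<and>
      regs (setr ''j'' (Suc j) s'') ''v'' = u div b ^ Suc j \<and>
      (\<forall>i<l. l - Suc j \<le> i \<longrightarrow> mem (setr ''j'' (Suc j) s'') ''E'' (m + i) = min c (digit b u (l - Suc i))) \<and>
      (\<forall>x<m. mem (setr ''j'' (Suc j) s'') ''E'' x = mem s ''E'' x) \<and> t + 8 = 19 * Suc j) t s'"
    apply (simp add: I[THEN conjunct1] I[THEN conjunct2, THEN conjunct1] reads a)
    using I j by (auto simp: Suc_diff_Suc)
qed (use assms in \<open>auto simp: tables_def params_def\<close>)

end

text \<open>The search leaves in \<open>X\<close> the last choice it tried, so the best one is
  evaluated anew before the output. With \<open>e = 0\<close> no anonymization exists and nothing is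
  written.\<close>

definition Main :: com where
  "Main = Assign ''b'' (Add (Reg ''c'') (Reg ''c'')) ;; Assign ''K'' (Add (Reg ''k'') (Reg ''k'')) ;;
    Pow ''U'' ''b'' ''l'' ;; Tables ;; Read ;; Pow ''Z'' ''K'' ''U'' ;; Search ;;
    Cond (Reg ''e'') (Assign ''z'' (Reg ''g'') ;; Evaluate ;; Output) Skip"

definition Program :: com where
  "Program = Cond (Reg ''l'') Main Skip"

text \<open>Moving one pointer raises the sum of all pointers by the distance moved; this sum is the
  potential in the amortized bound for the output.\<close>

lemma sum_fun_upd:
  fixes f :: "'a \<Rightarrow> nat"
  assumes "finite A" "r \<in> A"
  shows "sum (f(r := h)) A + f r = sum f A + h"
proof -
  have "sum (f(r := h)) (A - {r}) = sum f (A - {r})" by (rule sum.cong) auto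
  then show ?thesis using assms by (simp add: sum.remove[of A r])
qed

section \<open>The output phase and the whole program\<close>

context ram
begin

text \<open>The function \<open>f\<close> records the copies given to the first \<open>i\<close>
  rows and is no part of the machine state; \<open>X\<close> holds what is left of the
  configuration, and the pointers \<open>Hd\<close> have passed used-up copies only.\<close>

definition "placed z f i X Hd E \<longleftrightarrow>
  (\<forall>i'<i. f i' < U \<and> R (f i') = code i' \<and> (\<forall>j<l. E (i' * l + j) = min c (digit b (f i') (l - Suc j)))) \<and>
  (\<forall>u<U. X u + card {i' \<in> {..<i}. f i' = u} = config z u) \<and>
  (\<forall>r<U. Hd r \<le> U \<and> (\<forall>u<U. u < Hd r \<longrightarrow> R u = r \<longrightarrow> X u = (0 :: nat)))"

lemma sum_placed:
  assumes "placed z f i X Hd E" "sums_ok z" "r < U" "R r = r"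
  shows "(\<Sum>u\<in>{u \<in> {..<U}. R u = r}. X u) + rows_before i r = rows_with r"
proof -
  have "(\<Sum>u\<in>{u \<in> {..<U}. R u = r}. X u) + (\<Sum>u\<in>{u \<in> {..<U}. R u = r}. card {i' \<in> {..<i}. f i' = u}) =
      (\<Sum>u\<in>{u \<in> {..<U}. R u = r}. config z u)"
    unfolding sum.distrib[symmetric] by (rule sum.cong) (use assms(1) in \<open>auto simp: placed_def\<close>)
  also have "\<dots> = rows_with r" using assms by (intro sum_config)
  also have "(\<Sum>u\<in>{u \<in> {..<U}. R u = r}. card {i' \<in> {..<i}. f i' = u}) =
      card {i' \<in> {..<i}. f i' \<in> {u \<in> {..<U}. R u = r}}"
    by (rule sum_card_fibres) auto
  also have "{i' \<in> {..<i}. f i' \<in> {u \<in> {..<U}. R u = r}} = {i' \<in> {..<i}. code i' = r}"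
    using assms(1) by (auto simp: placed_def)
  finally show ?thesis by (simp add: rows_before_def)
qed

text \<open>Row \<open>i\<close> itself is still to be written, so fewer than
  \<open>rows_with\<close> copies of its kind have been spent. Some copy is left, and it cannot lie
  behind the pointer.\<close>

lemma placed_free:
  assumes pl: "placed z f i X Hd E" and ok: "sums_ok z" and i: "i < n"
  shows "\<exists>u<U. R u = code i \<and> 0 < X u \<and> Hd (code i) \<le> u"
proof -
  have r: "code i < U" "R (code i) = code i" using i code_less R_code by auto
  have "rows_before (Suc i) (code i) \<le> rows_before n (code i)"
    unfolding rows_before_def by (rule card_mono) (use i in auto)
  then have "rows_before i (code i) < rows_with (code i)"
    by (simp add: rows_before_Suc rows_before_n)
  then have "(\<Sum>u\<in>{u \<in> {..<U}. R u = code i}. X u) \<noteq> 0"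
    using sum_placed[OF pl ok r] by linarith
  then obtain u where u: "u < U" "R u = code i" "0 < X u" by (auto simp: sum_nonneg_eq_0_iff)
  with pl r(1) have "\<not> u < Hd (code i)" by (auto simp: placed_def)
  with u show ?thesis by auto
qed

lemma placed_Suc:
  assumes pl: "placed z f i X Hd E" and i: "i < n"
    and h: "h < U" "R h = code i" "0 < X h" "\<And>v. Hd (code i) \<le> v \<Longrightarrow> v < h \<Longrightarrow> R v = code i \<Longrightarrow> X v = 0"
    and E: "\<And>j. j < l \<Longrightarrow> E' (i * l + j) = min c (digit b h (l - Suc j))" "\<And>x. x < i * l \<Longrightarrow> E' x = E x"
  shows "placed z (f(i := h)) (Suc i) (X(h := X h - 1)) (Hd(code i := h)) E'"
  unfolding placed_def
proof (intro conjI allI impI)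
  fix i' assume i': "i' < Suc i"
  show "(f(i := h)) i' < U" "R ((f(i := h)) i') = code i'"
    using i' pl h by (auto simp: placed_def less_Suc_eq)
  fix j assume j: "j < l"
  show "E' (i' * l + j) = min c (digit b ((f(i := h)) i') (l - Suc j))"
  proof (cases "i' = i")
    case False
    then have "Suc i' * l \<le> i * l" using i' by (intro mult_right_mono) auto
    then have "i' * l + j < i * l" using j by simp
    then show ?thesis using False i' j E(2) pl by (auto simp: placed_def)
  qed (use E(1) j in simp)
next
  fix u assume u: "u < U"
  have "{i' \<in> {..<Suc i}. (f(i := h)) i' = u} =
      (if u = h then insert i {i' \<in> {..<i}. f i' = u} else {i' \<in> {..<i}. f i' = u})"
    by (auto simp: less_Suc_eq)
  moreover have "X u + card {i' \<in> {..<i}. f i' = u} = config z u" using pl u by (auto simp: placed_def)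
  ultimately show "(X(h := X h - 1)) u + card {i' \<in> {..<Suc i}. (f(i := h)) i' = u} = config z u"
    using h(3) by auto
next
  fix r assume r: "r < U"
  show "(Hd(code i := h)) r \<le> U" using pl r h(1) by (auto simp: placed_def)
  fix u assume u: "u < U" "u < (Hd(code i := h)) r" "R u = r"
  have "X u = 0"
  proof (cases "r = code i \<and> Hd (code i) \<le> u")
    case True
    with u h(4) show ?thesis by simp
  next
    case False
    then have "u < Hd r" using u(2) by (auto split: if_splits)
    with pl r u show ?thesis by (auto simp: placed_def)
  qed
  then show "(X(h := X h - 1)) u = 0" using h(3) by auto
qed

text \<open>After all rows the copies spent on each kind of row equal its total supply, so every
  remainder in \<open>X\<close> is 0.\<close>

lemma placed_n:
  assumes pl: "placed z f n X Hd E" and ok: "sums_ok z"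
  shows "assignment f" "u < U \<Longrightarrow> copies f u = config z u"
proof -
  show "assignment f" using pl by (auto simp: placed_def assignment_def)
  assume u: "u < U"
  have "(\<Sum>v\<in>{v \<in> {..<U}. R v = R u}. X v) = 0"
    using sum_placed[OF pl ok R_less[OF u] R_idem[OF u]] by (simp add: rows_before_n)
  then have "X u = 0" using u by simp
  then show "copies f u = config z u" using pl u by (auto simp: placed_def copies_def)
qed

lemma wp_Output:
  assumes ld: "loaded s" and X: "\<forall>v<U. mem s ''X'' v = config z v" and ok: "sums_ok z"
    and Hd: "\<forall>r. mem s ''H'' r = 0"
  shows "wp w Output (\<lambda>t s'. (\<exists>f. assignment f \<and> (\<forall>u<U. copies f u = config z u) \<and>
    output_mat n l c s' = mat_of f) \<and> t \<le> 8 + n * (60 + 19 * l) + 24 * (U * U)) 0 s"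
proof -
  let ?J = "\<lambda>i s'. \<exists>f. placed z f i (mem s' ''X'') (mem s' ''H'') (mem s' ''E'')"
  \<comment> \<open>Amortization: pointer moves are charged to the sum of the pointers. Each of the
    \<open>U\<close> pointers is at most \<open>U\<close>, which bounds all moves together by
    \<open>U * U\<close> independently of \<open>n\<close>.\<close>
  let ?I = "\<lambda>i t s'. regs s' ''a'' = i * l \<and> ?J i s' \<and> t \<le> i * (60 + 19 * l) + 24 * (\<Sum>r<U. mem s' ''H'' r)"
  have main: "wp w (For ''i'' ''n'' Output_body) (\<lambda>t s''. (\<exists>f. assignment f \<and> (\<forall>u<U. copies f u = config z u) \<and>
    output_mat n l c s'' = mat_of f) \<and> t \<le> 6 + n * (60 + 19 * l) + 24 * (U * U)) 0 s'"
    if s': "loaded s'" "mem s' = mem s" "regs s' ''a'' = 0" for s'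
  proof (rule wp_For[where N = n and I = ?I])
    fix i t s''
    assume i: "i < n" and I: "?I i t s''" and ri: "regs s'' ''i'' = i"
      and f: "same (insert ''i'' (mod_regs Output_body)) (mod_mem Output_body) s' s''"
    have ld: "loaded s''" using loaded_same[OF s'(1) f] by simp
    let ?r = "code i" and ?X = "mem s'' ''X''" and ?H = "mem s'' ''H''" and ?E = "mem s'' ''E''"
    obtain g where pl: "placed z g i ?X ?H ?E" using I by blast
    from placed_free[OF pl ok i] obtain u where u: "u < U" "R u = ?r" "0 < ?X u" "?H ?r \<le> u" by blast
    have r: "?r < U" using code_less[OF i] .
    have reads: "mem s'' ''C'' i = ?r" "regs s'' ''l'' = l"
      using ld i by (simp_all add: loaded_def tables_def params_def)
    have "Suc i * l \<le> n * l" using i by (intro mult_right_mono) auto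
    then have al: "i * l + l < 2 ^ w" using H by (intro fits1) simp
    let ?Q = "\<lambda>t s0. ?I (Suc i) (t + 8) (setr ''i'' (Suc i) s0)"
    have row: "wp w (For ''j'' ''l'' Write_row) (wp w (Assign ''a'' (Add (Reg ''a'') (Reg ''l''))) ?Q) t1 s1"
      if h: "?H ?r \<le> h" "h \<le> u" "R h = ?r" "0 < ?X h"
          "\<And>v. ?H ?r \<le> v \<Longrightarrow> v < h \<Longrightarrow> R v = ?r \<Longrightarrow> ?X v = 0"
        and s1: "loaded s1" "mem s1 ''H'' = ?H(?r := h)" "mem s1 ''X'' = ?X(h := ?X h - 1)" "mem s1 ''E'' = ?E"
          "regs s1 ''v'' = h" "regs s1 ''a'' = i * l + l" "t1 \<le> t + (36 + 24 * (h - ?H ?r))"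
      for h t1 s1
    proof -
      have tab: "tables s1" using s1(1) by (simp add: loaded_def)
      have hU: "h < U" using h(2) u(1) by simp
      show ?thesis
      proof (rule wp_conseq[OF wp_Write_row[OF tab s1(5) hU s1(6)]])
        fix t' s2
        assume w: "(\<forall>j<l. mem s2 ''E'' (i * l + j) = min c (digit b h (l - Suc j))) \<and>
          (\<forall>x<i * l. mem s2 ''E'' x = mem s1 ''E'' x) \<and> regs s2 ''a'' = i * l \<and> t' = 6 + 19 * l"
          and f2: "same (mod_regs (For ''j'' ''l'' Write_row)) (mod_mem (For ''j'' ''l'' Write_row)) s1 s2"
        have m: "mem s2 ''H'' = ?H(?r := h)" "mem s2 ''X'' = ?X(h := ?X h - 1)" "regs s2 ''l'' = l"
          using sameM[OF f2] sameR[OF f2] s1 tab by (simp_all add: tables_def params_def)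
        have "placed z (g(i := h)) (Suc i) (mem s2 ''X'') (mem s2 ''H'') (mem s2 ''E'')"
          unfolding m by (rule placed_Suc[OF pl i hU h(3-5)]) (use w s1(4) in auto)
        then have J: "?J (Suc i) s2" by blast
        have "(\<Sum>r<U. mem s2 ''H'' r) + ?H ?r = (\<Sum>r<U. ?H r) + h"
          unfolding m by (rule sum_fun_upd) (use r in auto)
        then have "(\<Sum>r<U. mem s2 ''H'' r) = (\<Sum>r<U. ?H r) + (h - ?H ?r)" using h(1) by simp
        moreover have "t \<le> i * (60 + 19 * l) + 24 * (\<Sum>r<U. ?H r)" "t' = 6 + 19 * l" using I w by blast+
        ultimately have t: "t1 + t' + 12 \<le> Suc i * (60 + 19 * l) + 24 * (\<Sum>r<U. mem s2 ''H'' r)"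
          using s1(7) by simp
        show "wp w (Assign ''a'' (Add (Reg ''a'') (Reg ''l''))) ?Q (t1 + t') s2"
          using w m(3) al J t by (simp add: add.commute)
      qed
    qed
    have tab: "tables (setr ''r'' ?r s'')" using ld by (simp add: loaded_def)
    let ?rest = "wp w (Assign ''v'' (Load ''H'' (Reg ''r''))) (wp w (Store ''X'' (Reg ''v'') (Sub (Load ''X'' (Reg ''v'')) (Const 1)))
        (wp w (Assign ''a'' (Add (Reg ''a'') (Reg ''l'')))
        (wp w (For ''j'' ''l'' Write_row) (wp w (Assign ''a'' (Add (Reg ''a'') (Reg ''l''))) ?Q))))"
    have "wp w Find_loop ?rest (t + 3) (setr ''r'' ?r s'')"
    proof (rule wp_conseq[OF wp_Find_loop[OF tab, where r = ?r and u = u]])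
      fix t' s0
      assume "\<exists>h. mem (setr ''r'' ?r s'') ''H'' ?r \<le> h \<and> h \<le> u \<and> R h = ?r \<and> 0 < mem (setr ''r'' ?r s'') ''X'' h \<and>
        (\<forall>v. mem (setr ''r'' ?r s'') ''H'' ?r \<le> v \<longrightarrow> v < h \<longrightarrow> R v = ?r \<longrightarrow> mem (setr ''r'' ?r s'') ''X'' v = 0) \<and>
        mem s0 ''H'' = (mem (setr ''r'' ?r s'') ''H'')(?r := h) \<and> t' = 18 + 24 * (h - mem (setr ''r'' ?r s'') ''H'' ?r)"
        and f0: "same (mod_regs Find_loop) (mod_mem Find_loop) (setr ''r'' ?r s'') s0"
      then obtain h where h: "?H ?r \<le> h" "h \<le> u" "R h = ?r" "0 < ?X h"
          "\<And>v. ?H ?r \<le> v \<Longrightarrow> v < h \<Longrightarrow> R v = ?r \<Longrightarrow> ?X v = 0"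
          "mem s0 ''H'' = ?H(?r := h)" "t' = 18 + 24 * (h - ?H ?r)" by auto
      have "loaded (setr ''r'' ?r s'')" using ld by simp
      then have ld0: "loaded s0" using loaded_same[OF _ f0] by simp
      have r0: "regs s0 ''r'' = ?r" "regs s0 ''a'' = i * l" "regs s0 ''l'' = l" "mem s0 ''X'' = ?X" "mem s0 ''E'' = ?E"
        using sameR[OF f0] sameM[OF f0] I reads by simp_all
      show "?rest (t + 3 + t') s0"
        by (simp add: r0 h(6) al, rule row[OF h(1-5)]) (use ld0 h r0 in simp_all)
    qed (use u r in simp_all)
    then show "wp w Output_body ?Q t s''"
      unfolding wp.simps(4) by (simp add: reads ri numeral_eq_Suc)
  next
    fix t s''
    assume I: "?I n t s''"
      and f: "same (insert ''i'' (mod_regs Output_body)) (mod_mem Output_body) s' s''"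
    then obtain g where pl: "placed z g n (mem s'' ''X'') (mem s'' ''H'') (mem s'' ''E'')" by blast
    then have "output_mat n l c s'' = mat_of g"
      unfolding output_mat_def mat_of_def by (intro cong_mat) (auto simp: placed_def)
    moreover have "(\<Sum>r<U. mem s'' ''H'' r) \<le> (\<Sum>r<U. U)"
      by (rule sum_mono) (use pl in \<open>auto simp: placed_def\<close>)
    then have "t + 6 \<le> 6 + n * (60 + 19 * l) + 24 * (U * U)" using I by simp
    ultimately show "(\<exists>f. assignment f \<and> (\<forall>u<U. copies f u = config z u) \<and>
      output_mat n l c s'' = mat_of f) \<and> t + 6 \<le> 6 + n * (60 + 19 * l) + 24 * (U * U)"
      using placed_n[OF pl ok] by blast
  next
    show "?I 0 0 (setr ''i'' 0 s')"
      using s' X Hd by (simp add: placed_def)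
  qed (use s' in \<open>auto simp: loaded_def tables_def params_def\<close>)
  show ?thesis
    unfolding Output_def by (simp; rule wp_conseq[OF main]; use ld in simp)
qed

lemma wp_Main:
  assumes regs: "regs s ''n'' = n" "regs s ''l'' = l" "regs s ''c'' = c" "regs s ''k'' = k"
    and D_mem: "\<forall>x<n * l. mem s ''D'' x = D $$ (x div l, x mod l)"
    and zero: "\<And>a x. a \<noteq> ''D'' \<Longrightarrow> mem s a x = 0"
  shows "wp w Main (\<lambda>t s'. ((\<exists>E. k_anonymization k D E) \<longrightarrow> optimal_k_anonymization k D (output_mat n l c s')) \<and>
    t \<le> 100 + l * (18 + 12 * b) + 80 * U + U * (18 + 12 * K) + Z * (60 + U * (106 + 27 * Z)) +
      U * (106 + 27 * Z) + 24 * (U * U) + n * (85 + 37 * l)) 0 s"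
    (is "wp w Main ?Q 0 s")
proof -
  let ?rest6 = "wp w (Cond (Reg ''e'') (Assign ''z'' (Reg ''g'') ;; Evaluate ;; Output) Skip) ?Q"
  let ?rest5 = "wp w Search ?rest6"
  let ?rest4 = "wp w (Pow ''Z'' ''K'' ''U'') ?rest5"
  let ?rest3 = "wp w Read ?rest4"
  let ?rest2 = "wp w Tables ?rest3"
  \<comment> \<open>Each \<open>?t\<close> bounds the clock at the start of the correspondingly
    numbered remainder of the program; \<open>16\<close> is 8 for the two assignments and 8 from
    \<open>Pow\<close>.\<close>
  let ?t2 = "16 + l * (18 + 12 * b)"
  let ?t3 = "?t2 + (12 + 80 * U)"
  let ?t4 = "?t3 + (8 + n * (25 + 18 * l))"
  let ?t5 = "?t4 + (8 + U * (18 + 12 * K))"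
  let ?t6 = "?t5 + (10 + Z * (60 + U * (106 + 27 * Z)))"
  let ?t7 = "?t6 + 4 + (30 + U * (106 + 27 * Z))"
  have 7: "wp w Output ?Q t s'"
    if "loaded s'" "\<forall>v<U. mem s' ''X'' v = config z v" "feasible z" "\<forall>r. mem s' ''H'' r = 0"
      "\<And>z'. z' < K ^ U \<Longrightarrow> feasible z' \<Longrightarrow> stars z \<le> stars z'" "t \<le> ?t7" for t s' z
  proof (rule wp_conseq[OF wp_Output[OF that(1,2) _ that(4)]])
    show "sums_ok z" using that(3) by (simp add: feasible_def)
    fix t' s''
    assume *: "(\<exists>f. assignment f \<and> (\<forall>u<U. copies f u = config z u) \<and>
      output_mat n l c s'' = mat_of f) \<and> t' \<le> 8 + n * (60 + 19 * l) + 24 * (U * U)"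
    then obtain f where "assignment f" "\<forall>u<U. copies f u = config z u" "output_mat n l c s'' = mat_of f" by blast
    then have "optimal_k_anonymization k D (output_mat n l c s'')"
      using optimal_mat_of[OF that(3,5)] by simp
    then show "?Q (t + t') s''" using * that(6) by (simp add: algebra_simps)
  qed
  have 6: "?rest6 t s'" if "loaded s'" "best Z (regs s' ''e'') (regs s' ''g'')" "\<forall>r. mem s' ''H'' r = 0" "t \<le> ?t6" for t s'
  proof (cases "regs s' ''e'' = 0")
    case True
    \<comment> \<open>If no choice is feasible, no anonymization exists, and the claim on the output
      is vacuous.\<close>
    then have "\<not> (\<exists>E. k_anonymization k D E)"
      using that(2) feasible_if_k_anonymization by (auto simp: best_def Z_def)
    moreover have "n * (25 + 18 * l) \<le> n * (85 + 37 * l)" by (intro mult_left_mono) auto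
    ultimately have "?Q (t + 3) s'" using that(4) by (intro conjI) (blast, linarith)
    then show ?thesis by (simp add: True numeral_eq_Suc)
  next
    case False
    let ?g = "regs s' ''g''"
    have g: "?g < Z" "feasible ?g" "\<And>z'. z' < K ^ U \<Longrightarrow> feasible z' \<Longrightarrow> stars ?g \<le> stars z'"
      using that(2) False by (auto simp: best_def Z_def)
    have "wp w Evaluate (wp w Output ?Q) (t + 4) (setr ''z'' ?g s')"
    proof (rule wp_conseq[OF wp_Evaluate[where z = ?g]])
      show ld: "loaded (setr ''z'' ?g s')" using that(1) by simp
      fix t' s''
      assume *: "(\<forall>v<U. mem s'' ''X'' v = config ?g v) \<and> regs s'' ''s'' = stars ?g \<and>
        regs s'' ''o'' = of_bool (feasible ?g) \<and> t' \<le> 30 + U * (106 + 27 * Z)"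
        and f: "same (mod_regs Evaluate) (mod_mem Evaluate) (setr ''z'' ?g s') s''"
      have "loaded s''" using loaded_same[OF ld f] by simp
      moreover have "mem s'' ''H'' = mem s' ''H''" using sameM[OF f] by simp
      ultimately show "wp w Output ?Q (t + 4 + t') s''"
        by (intro 7[of _ ?g]) (use * that(3,4) g in auto)
    qed (use g in simp_all)
    then show ?thesis using False by (simp add: numeral_eq_Suc)
  qed
  have 5: "?rest5 t s'" if "loaded s'" "regs s' ''Z'' = Z" "\<forall>r. mem s' ''H'' r = 0" "t \<le> ?t5" for t s'
  proof (rule wp_conseq[OF wp_Search[OF that(1,2)]])
    fix t' s'' assume *: "best Z (regs s'' ''e'') (regs s'' ''g'') \<and> t' \<le> 10 + Z * (60 + U * (106 + 27 * Z))"
      and f: "same (mod_regs Search) (mod_mem Search) s' s''"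
    have "loaded s''" using loaded_same[OF that(1) f] by simp
    moreover have "mem s'' ''H'' = mem s' ''H''" using sameM[OF f] by simp
    ultimately show "?rest6 (t + t') s''" by (intro 6) (use * that in simp_all)
  qed
  have 4: "?rest4 t s'" if "loaded s'" "\<forall>r. mem s' ''H'' r = 0" "t \<le> ?t4" for t s'
  proof (rule wp_conseq[OF wp_Pow[where B = K and m = U]])
    show "regs s' ''K'' = K" "regs s' ''U'' = U" using that(1) by (simp_all add: loaded_def tables_def params_def)
    show "K ^ U < 2 ^ w" using H by (intro fits1)
    fix t' s'' assume *: "regs s'' ''Z'' = K ^ U \<and> t' \<le> 8 + U * (18 + 12 * K)"
      and f: "same (mod_regs (Pow ''Z'' ''K'' ''U'')) (mod_mem (Pow ''Z'' ''K'' ''U'')) s' s''"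
    have "loaded s''" using loaded_same[OF that(1) f] by simp
    moreover have "mem s'' ''H'' = mem s' ''H''" using sameM[OF f] by simp
    ultimately show "?rest5 (t + t') s''" by (intro 5) (use * that in \<open>simp_all add: Z_def\<close>)
  qed (use K in simp_all)
  have 3: "?rest3 t s'" if "tables s'" "\<forall>x<n * l. mem s' ''D'' x = D $$ (x div l, x mod l)"
    "\<forall>u. mem s' ''N'' u = 0" "\<forall>r. mem s' ''H'' r = 0" "t \<le> ?t3" for t s'
  proof (rule wp_conseq[OF wp_Read[OF that(1-3)]])
    fix t' s'' assume *: "loaded s'' \<and> t' \<le> 8 + n * (25 + 18 * l)"
      and f: "same (mod_regs Read) (mod_mem Read) s' s''"
    have "mem s'' ''H'' = mem s' ''H''" using sameM[OF f] by simp
    then show "?rest4 (t + t') s''" by (intro 4) (use * that in simp_all)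
  qed
  have 2: "?rest2 t s'" if "params s'" "mem s' = mem s" "t \<le> ?t2" for t s'
  proof (rule wp_conseq[OF wp_Tables[OF that(1)]])
    fix t' s'' assume *: "tables s'' \<and> t' \<le> 12 + 80 * U"
      and f: "same (mod_regs Tables) (mod_mem Tables) s' s''"
    have "mem s'' ''H'' = mem s ''H''" "mem s'' ''N'' = mem s ''N''" "mem s'' ''D'' = mem s ''D''"
      using sameM[OF f] that(2) by simp_all
    then show "?rest3 (t + t') s''" by (intro 3) (use * that D_mem zero in simp_all)
  qed (use that zero in simp_all)
  have 1: "wp w (Pow ''U'' ''b'' ''l'') ?rest2 8 (setr ''K'' K (setr ''b'' b s))"
  proof (rule wp_conseq[OF wp_Pow[where B = b and m = l]])
    show "b ^ l < 2 ^ w" using H by (intro fits1) (simp add: U_def)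
    fix t' s'' assume *: "regs s'' ''U'' = b ^ l \<and> t' \<le> 8 + l * (18 + 12 * b)"
      and f: "same (mod_regs (Pow ''U'' ''b'' ''l'')) (mod_mem (Pow ''U'' ''b'' ''l'')) (setr ''K'' K (setr ''b'' b s)) s''"
    have "params s''" using * regs by (simp add: params_def U_def sameR[OF f])
    moreover have "mem s'' = mem s" using f by (auto simp: same_def fun_eq_iff)
    ultimately show "?rest2 (8 + t') s''" by (intro 2) (use * in simp_all)
  qed (use b regs in auto)
  have "c + c < 2 ^ w" "k + k < 2 ^ w" "c + c = b" "k + k = K"
    using cH by (auto intro!: fits2 simp: b_def K_def)
  then show ?thesis
    unfolding Main_def wp.simps(4) using 1 regs by (simp add: numeral_eq_Suc)
qed

end

section \<open>Running time and word size\<close>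

lemma (in ram) Main_time:
  "102 + l * (18 + 12 * b) + 80 * U + U * (18 + 12 * K) + Z * (60 + U * (106 + 27 * Z)) +
    U * (106 + 27 * Z) + 24 * (U * U) + n * (85 + 37 * l) \<le> 2 ^ (6 * (k\<^sup>2 * (2 * c) ^ l)) + 122 * (n * l)"
proof -
  have le: "l \<le> Z" "b \<le> Z" "U \<le> Z" "K \<le> Z" using UZ b_le_U l_less_U by auto
  \<comment> \<open>\<open>K \<ge> 4\<close> because of \<open>k \<ge> 2\<close>, and
    \<open>U \<ge> b \<ge> 2\<close>.\<close>
  have "(4 :: nat) ^ 2 \<le> K ^ U"
  proof (rule order.trans[OF power_mono[of 4 K 2]])
    show "K\<^sup>2 \<le> K ^ U" using K b b_le_U by (intro power_increasing) auto
  qed (use K in auto)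
  then obtain y where y: "Z = 16 + y" by (auto simp: Z_def le_iff_add)
  have "102 + l * (18 + 12 * b) + 80 * U + U * (18 + 12 * K) + Z * (60 + U * (106 + 27 * Z)) +
      U * (106 + 27 * Z) + 24 * (U * U) \<le>
    102 + Z * (18 + 12 * Z) + 80 * Z + Z * (18 + 12 * Z) + Z * (60 + Z * (106 + 27 * Z)) +
      Z * (106 + 27 * Z) + 24 * (Z * Z)"
    using le by (intro add_mono mult_mono order.refl) auto
  \<comment> \<open>\<open>4096 = 16 ^ 3\<close> is absorbed by another \<open>Z ^ 3\<close>.
    Substituting \<open>Z = 16 + y\<close> reduces the cubic inequality to comparing
    coefficients.\<close>
  also have "\<dots> \<le> 4096 * Z ^ 3" unfolding y by (simp add: algebra_simps power3_eq_cube)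
  also have "\<dots> \<le> Z ^ 3 * Z ^ 3"
    using power_mono[of 16 Z 3] y by (intro mult_right_mono) auto
  also have "\<dots> = Z ^ 6" by (simp flip: power_add)
  also have "\<dots> \<le> (2 ^ (k\<^sup>2 * (2 * c) ^ l)) ^ 6" unfolding Z_def by (intro power_mono configs_le) simp
  also have "\<dots> = 2 ^ (6 * (k\<^sup>2 * (2 * c) ^ l))" by (simp flip: power_mult add: mult.commute)
  finally have "102 + l * (18 + 12 * b) + 80 * U + U * (18 + 12 * K) + Z * (60 + U * (106 + 27 * Z)) +
      U * (106 + 27 * Z) + 24 * (U * U) \<le> 2 ^ (6 * (k\<^sup>2 * (2 * c) ^ l))" .
  moreover have "n * (85 + 37 * l) \<le> 122 * (n * l)"
    using mult_le_mono2[of "85 + 37 * l" "122 * l" n] l by simp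
  ultimately show ?thesis by (rule add_mono)
qed

text \<open>The logarithmic hypothesis says \<open>H ^ 5 \<le> 2 ^ w\<close>; the spare factor
  \<open>H \<ge> 2\<close> makes the bound on \<open>H ^ 4\<close> strict.\<close>

lemma power_less_if_log_le:
  assumes "2 \<le> H" "real 5 * log 2 (real H) \<le> real w"
  shows "H ^ 4 < 2 ^ w"
proof -
  have "real (H ^ 5) = 2 powr (real 5 * log 2 (real H))"
  proof -
    have "2 powr (real 5 * log 2 (real H)) = (2 powr log 2 (real H)) powr real 5"
      by (simp only: powr_powr mult.commute)
    also have "\<dots> = real H powr real 5" using assms(1) by simp
    also have "\<dots> = real H ^ 5" by (rule powr_realpow) (use assms(1) in simp)
    finally show ?thesis by simp
  qed
  also have "\<dots> \<le> 2 powr real w" using assms(2) by (intro powr_mono) auto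
  also have "\<dots> = real (2 ^ w)" by (simp add: powr_realpow)
  finally have "H ^ 5 \<le> 2 ^ w" by (simp only: of_nat_le_iff)
  moreover have "H ^ 4 < H ^ 5" using assms(1) by (intro power_strict_increasing) auto
  ultimately show ?thesis by simp
qed

text \<open>Without columns, \<open>n\<close> and \<open>c\<close> are not bounded by the time allowed, but there is nothing to compute.\<close>

lemma no_columns_optimal:
  assumes "D \<in> carrier_mat n 0" "\<exists>E. k_anonymization k D E"
  shows "optimal_k_anonymization k D (output_mat n 0 c s)"
proof -
  have "E = output_mat n 0 c s" if "k_anonymization k D E" for E
    using that assms(1) by (intro eq_matI) (auto simp: k_anonymization_def suppression_def output_mat_def)
  with assms(2) show ?thesis
    unfolding optimal_k_anonymization_def is_arg_min_def by (metis less_irrefl)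
qed

theorem theorem4:
  "\<exists>(P :: com) (A :: nat) (B :: nat) (C :: nat).
     \<forall>(n :: nat) (l :: nat) (c :: nat) (k :: nat) (D :: nat mat) (w :: nat) (T :: nat).
       1 \<le> c \<longrightarrow> 2 \<le> k \<longrightarrow> D \<in> carrier_mat n l \<longrightarrow> elements_mat D \<subseteq> {..<c} \<longrightarrow>
       T = 2 ^ (A * (k\<^sup>2 * (2 * c) ^ l)) + B * (n * l) \<longrightarrow>
       real C * log 2 (real (n + T)) \<le> real w \<longrightarrow>
       (\<exists>t s. exec w P (input_state c k D) t s \<and> t \<le> T \<and>
          ((\<exists>E. k_anonymization k D E) \<longrightarrow>
             optimal_k_anonymization k D (output_mat n l c s)))"
\<comment> \<open>\<open>6\<close>: the part independent of \<open>n\<close> takes at most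
  \<open>Z ^ 6\<close> steps. \<open>122\<close>: reading and writing cost at most
  \<open>(25 + 18 * l) + (60 + 19 * l)\<close> per row, up to constants, and
  \<open>85 + 37 * l \<le> 122 * l\<close> for \<open>l \<ge> 1\<close>. \<open>5\<close>: one more
  than the exponent in the bound on all values.\<close>
proof (rule exI[of _ Program], rule exI[of _ 6], rule exI[of _ 122], rule exI[of _ 5], intro allI impI)
  fix n l c k w T :: nat and D :: "nat mat"
  assume c: "1 \<le> c" and k: "2 \<le> k" and D: "D \<in> carrier_mat n l" and el: "elements_mat D \<subseteq> {..<c}"
    and T: "T = 2 ^ (6 * (k\<^sup>2 * (2 * c) ^ l)) + 122 * (n * l)"
    and w: "real 5 * log 2 (real (n + T)) \<le> real w"
  let ?s = "input_state c k D"
  let ?opt = "\<lambda>s. (\<exists>E. k_anonymization k D E) \<longrightarrow> optimal_k_anonymization k D (output_mat n l c s)"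
  have dims: "dim_row D = n" "dim_col D = l" using D by auto
  have regs: "regs ?s ''n'' = n" "regs ?s ''l'' = l" "regs ?s ''c'' = c" "regs ?s ''k'' = k"
    by (simp_all add: input_state_def dims)
  show "\<exists>t s. exec w Program ?s t s \<and> t \<le> T \<and> ?opt s"
  proof (cases "l = 0")
    case True
    \<comment> \<open>Without columns the program takes 3 steps, 2 for the test and 1 for
      \<open>Skip\<close>; since \<open>n * l\<close> vanishes, they must fit into the power of
      two.\<close>
    have "2 * 2 \<le> k * k" using k by (intro mult_mono) auto
    then have "(2 :: nat) ^ 2 \<le> 2 ^ (6 * (k\<^sup>2 * (2 * c) ^ l))"
      using True k by (intro power_increasing) (simp_all add: power2_eq_square)
    then have "3 \<le> T" using T by simp
    moreover have "exec w Program ?s (1 + ops (Reg ''l'') + 1) ?s"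
      unfolding Program_def using True by (intro exec.CondFalse exec.Skip) (simp_all add: regs)
    ultimately show ?thesis using True D no_columns_optimal[of D n] by (intro exI[of _ 3] exI[of _ ?s]) (auto simp: numeral_eq_Suc)
  next
    case False
    interpret database n l c k D using c k False D el by unfold_locales auto
    \<comment> \<open>The quantity in the hypothesis on the word size. It dominates
      \<open>K ^ U\<close>, hence \<open>U\<close>, \<open>b\<close>, \<open>K\<close> and
      \<open>l\<close>, and through \<open>T\<close> also \<open>n * l\<close>.\<close>
    let ?H = "n + T"
    have Z: "K ^ U \<le> ?H"
    proof -
      have "K ^ U \<le> 2 ^ (k\<^sup>2 * (2 * c) ^ l)" by (rule configs_le)
      also have "\<dots> \<le> 2 ^ (6 * (k\<^sup>2 * (2 * c) ^ l))" by (intro power_increasing) auto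
      finally show ?thesis using T by simp
    qed
    interpret ram n l c k D w ?H
    proof unfold_locales
      show "n * l \<le> ?H" using T by simp
      show "l \<le> ?H" using l_less_U U_le_configs Z by linarith
      show "2 \<le> ?H" using K K_le_configs Z by linarith
      then show "?H ^ 4 < 2 ^ w" using w by (rule power_less_if_log_le)
    qed (use U_le_configs b_le_U K_le_configs Z in auto)
    have D_mem: "\<forall>x<n * l. mem ?s ''D'' x = D $$ (x div l, x mod l)"
      and zero: "\<And>a x. a \<noteq> ''D'' \<Longrightarrow> mem ?s a x = 0"
      by (simp_all add: input_state_def dims)
    have "mem ?s a x \<le> c" for a x
    proof -
      have "D $$ (x div l, x mod l) < c" if "x < n * l"
        using that False by (intro D_less) (auto simp: less_mult_imp_div_less)
      then show ?thesis by (auto simp: input_state_def dims intro: less_imp_le)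
    qed
    then have "mem ?s a x < 2 ^ w" for a x using cH by (meson fits1 order.trans)
    moreover have "regs ?s r < 2 ^ w" for r
      using cH H by (auto simp: input_state_def dims intro!: fits1)
    ultimately have bnd: "bounded w ?s" by (simp add: bounded_def)
    have "wp w Program (\<lambda>t s'. ?opt s' \<and> t \<le> T) 0 ?s"
      unfolding Program_def wp.simps
    proof (intro conjI impI)
      \<comment> \<open>The test of \<open>l\<close> has already taken 2 steps, which turn the
        \<open>100\<close> of \<open>wp_Main\<close> into the \<open>102\<close> of
        \<open>Main_time\<close>.\<close>
      show "wp w Main (\<lambda>t s'. ?opt s' \<and> t \<le> T) (0 + (1 + ops (Reg ''l''))) ?s"
        by (rule wp_conseq[OF wp_Main[OF regs D_mem zero]]) (use Main_time T in auto)
    qed (use False regs in simp_all)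
    from halts_if_wp[OF this] bnd show ?thesis unfolding halts_def by auto
  qed
qed

end
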